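(* Let $u\in H^1_0(\Omega)$ be the solution of $a(u,v)=\langle f,v\rangle_\Omega$ for all $v\in H^1_0(\Omega)$, and let $u_h\in V_{\mathcal P}$ be the unique solution of $$a(u_h^+,v_h)+s(u_h^-,v_h)=\langle f,v_h\rangle_\Omega\qquad\forall\, v_h\in V_{\mathcal P}.$$ Then $$\|u-u_h^+\|_a=\min_{v_h\in V_{\mathcal P}^+}\|u-v_h\|_a .$$ Moreover, let $u_h^{\rm FEM}\in V_{\mathcal P}$ be the solution of the standard finite element method $a(u_h^{\rm FEM},v_h)=\langle f,v_h\rangle_\Omega$ for all $v_h\in V_{\mathcal P}$. Then $u_h^-$ satisfies $$s(u_h^-,u_h^-)^{1/2}\le \sqrt{\frac{C_{\rm equiv}}{\alpha}}\;\min\big\{\|u-u_h^+\|_a,\ \|u_h^{\rm FEM}-u_h^+\|_a\big\}.$$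
   Context: Setting. $\Omega\subset\mathbb R^d$, $d\in\{1,2,3\}$, is an open bounded domain with polyhedral Lipschitz boundary; $f\in H^{-1}(\Omega)$, and $\langle\cdot,\cdot\rangle_\Omega$ is the duality pairing of $H^{-1}(\Omega)$ and $H^1_0(\Omega)$ (extending the $L^2$ inner product $(\cdot,\cdot)_\Omega$). The diffusion tensor $\mathcal D\in L^\infty(\Omega)^{d\times d}$ is symmetric and there is $d_0>0$ with $y^T\mathcal D(x)y\ge d_0|y|^2$ for all $y\in\mathbb R^d$ and a.e. $x\in\Omega$. The reaction coefficient $\mu\in L^\infty(\Omega)$ satisfies $\mu\ge\mu_0\ge0$ a.e. Set $$a(v,w)=(\mathcal D\nabla v,\nabla w)_\Omega+(\mu v,w)_\Omega,\qquad \|v\|_a=\sqrt{a(v,v)}.$$ Finite elements. $\mathcal P$ is a conforming, shape-regular partition of $\Omega$ into simplices (or affine quadrilaterals/hexahedra) $K$ with diameters $h_K$; $h=\max_K h_K$; $k\ge1$; $V_{\mathcal P}$ is the space of functions in $C^0(\Omega)\cap H^1_0(\Omega)$ whose restriction to each $K$ is in $\mathbb P_k(K)$ (simplices) or $\mathbb Q_k(K)$ (affinely mapped polynomials of degree $\le k$ in each variable, for quadrilaterals/hexahedra). $x_1,\dots,x_N$ are the internal Lagrange nodes and $\phi_1,\dots,\phi_N$ the associated Lagrange basis of $V_{\mathcal P}$. For a node $x$, $K_x$ is the set of elements containing $x$ (also identified with the union of these elements). The mesh function $\mathfrak h$ is the continuous, element-wise linear (degree $k=1$) function whose value at each vertex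 $x$ of $\mathcal P$ is the average $\frac{1}{\#K_x}\sum_{K\in K_x}h_K$. $\omega_i$ is the union of all $K\in\mathcal P$ with $K\cap K_{x_i}\ne\emptyset$. Constrained and complementary parts. $\mathfrak a>0$ is a given constant, $V_{\mathcal P}^+=\{v_h\in V_{\mathcal P}: v_h(x_i)\in[0,\mathfrak a],\ i=1,\dots,N\}$. For $v_h\in V_{\mathcal P}$, $$v_h^+=\sum_{i=1}^N\max\{0,\min\{v_h(x_i),\mathfrak a\}\}\phi_i,\qquad v_h^-=v_h-v_h^+ .$$ Stabilisation. For $\alpha>0$, $$s(v,w)=\alpha\sum_{i=1}^N\big(\|\mathcal D\|_{0,\infty,\omega_i}\mathfrak h(x_i)^{d-2}+\|\mu\|_{0,\infty,\omega_i}\mathfrak h(x_i)^d\big)v(x_i)w(x_i),$$ where $\|\cdot\|_{0,\infty,\omega_i}$ is the $L^\infty(\omega_i)$-norm (with a fixed matrix norm for $\mathcal D$), and $\|v\|_s=\sqrt{s(v,v)}$. $C_{\rm equiv}>0$ is a constant depending only on the shape-regularity constant (in particular not on $\alpha$) such that $$\|v_h\|_a^2\le\frac{C_{\rm equiv}}{\alpha}\|v_h\|_s^2\qquad\forall\, v_h\in V_{\mathcal P}.$$ *)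

theory Defs
  imports "HOL-Analysis.Analysis" "HOL-Probability.Essential_Supremum"
begin

text \<open>
  Functions on a domain \<open>\<Omega>\<close> are represented by total functions on \<open>\<real>\<^sup>d\<close> whose values outside
  \<open>\<Omega>\<close> are never inspected (outside the closure of \<open>\<Omega>\<close> for the mesh function).
\<close>

section \<open>The domain\<close>

text \<open>
  Near each boundary point, \<open>\<Omega>\<close> is the strict epigraph of a Lipschitz function over the
  hyperplane orthogonal to some unit vector \<open>e\<close>.
\<close>

definition lipschitz_boundary :: "(real^'n) set \<Rightarrow> bool" where
  "lipschitz_boundary \<Omega> \<longleftrightarrow>
     (\<forall>p\<in>frontier \<Omega>. \<exists>e g L U. norm e = 1 \<and> L-lipschitz_on {y. y \<bullet> e = 0} g \<and> open U \<and> p \<in> U \<and>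
        \<Omega> \<inter> U = {x \<in> U. g (x - (x \<bullet> e) *\<^sub>R e) < x \<bullet> e})"

definition polyhedral_lipschitz_domain :: "(real^'n) set \<Rightarrow> bool" where
  "polyhedral_lipschitz_domain \<Omega> \<longleftrightarrow>
     open \<Omega> \<and> connected \<Omega> \<and> \<Omega> \<noteq> {} \<and> bounded \<Omega> \<and>
     (\<exists>F. finite F \<and> (\<forall>S\<in>F. polytope S) \<and> closure \<Omega> = \<Union>F) \<and>
     lipschitz_boundary \<Omega>"

section \<open>Sobolev spaces\<close>

definition L2 :: "(real^'n) set \<Rightarrow> (real^'n \<Rightarrow> 'b::euclidean_space) \<Rightarrow> bool" where
  "L2 \<Omega> v \<longleftrightarrow> v \<in> borel_measurable (lebesgue_on \<Omega>) \<and>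
     integrable (lebesgue_on \<Omega>) (\<lambda>x. (norm (v x))\<^sup>2)"

definition Linf :: "(real^'n) set \<Rightarrow> (real^'n \<Rightarrow> real) \<Rightarrow> bool" where
  "Linf \<Omega> g \<longleftrightarrow> g \<in> borel_measurable (lebesgue_on \<Omega>) \<and>
     (\<exists>C. AE x in lebesgue_on \<Omega>. \<bar>g x\<bar> \<le> C)"

definition linf_norm :: "(real^'n) set \<Rightarrow> (real^'n \<Rightarrow> real) \<Rightarrow> real" where
  "linf_norm S g = real_of_ereal (esssup (lebesgue_on S) (\<lambda>x. ereal \<bar>g x\<bar>))"

definition classical_grad :: "(real^'n \<Rightarrow> real) \<Rightarrow> real^'n \<Rightarrow> real^'n" where
  "classical_grad \<psi> x = (\<chi> i. frechet_derivative \<psi> (at x) (axis i 1))"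

fun cont_diff :: "nat \<Rightarrow> (real^'n \<Rightarrow> real) \<Rightarrow> bool" where
  "cont_diff 0 \<psi> \<longleftrightarrow> continuous_on UNIV \<psi>"
| "cont_diff (Suc m) \<psi> \<longleftrightarrow>
     (\<forall>x. \<psi> differentiable (at x)) \<and> (\<forall>i. cont_diff m (\<lambda>x. classical_grad \<psi> x $ i))"

text \<open>\<open>C\<^sub>c\<^sup>\<infinity>(\<Omega>)\<close>, each function extended by zero.\<close>

definition test_function :: "(real^'n) set \<Rightarrow> (real^'n \<Rightarrow> real) \<Rightarrow> bool" where
  "test_function \<Omega> \<psi> \<longleftrightarrow> (\<forall>m. cont_diff m \<psi>) \<and>
     compact (closure {x. \<psi> x \<noteq> 0}) \<and> closure {x. \<psi> x \<noteq> 0} \<subseteq> \<Omega>"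

definition weak_gradient ::
    "(real^'n) set \<Rightarrow> (real^'n \<Rightarrow> real) \<Rightarrow> (real^'n \<Rightarrow> real^'n) \<Rightarrow> bool" where
  "weak_gradient \<Omega> v g \<longleftrightarrow> L2 \<Omega> g \<and>
     (\<forall>\<psi> i. test_function \<Omega> \<psi> \<longrightarrow>
        (LINT x|lebesgue_on \<Omega>. v x * classical_grad \<psi> x $ i) =
        - (LINT x|lebesgue_on \<Omega>. g x $ i * \<psi> x))"

text \<open>The weak gradient is unique only up to null sets; \<open>grad\<close> picks a representative.\<close>

definition grad :: "(real^'n) set \<Rightarrow> (real^'n \<Rightarrow> real) \<Rightarrow> real^'n \<Rightarrow> real^'n" where
  "grad \<Omega> v = (SOME g. weak_gradient \<Omega> v g)"

definition H1 :: "(real^'n) set \<Rightarrow> (real^'n \<Rightarrow> real) set" where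
  "H1 \<Omega> = {v. L2 \<Omega> v \<and> (\<exists>g. weak_gradient \<Omega> v g)}"

definition H1_norm :: "(real^'n) set \<Rightarrow> (real^'n \<Rightarrow> real) \<Rightarrow> real" where
  "H1_norm \<Omega> v = sqrt ((LINT x|lebesgue_on \<Omega>. (v x)\<^sup>2) +
                       (LINT x|lebesgue_on \<Omega>. (norm (grad \<Omega> v x))\<^sup>2))"

text \<open>The closure of \<open>C\<^sub>c\<^sup>\<infinity>(\<Omega>)\<close> in \<open>H\<^sup>1(\<Omega>)\<close>.\<close>

definition H10 :: "(real^'n) set \<Rightarrow> (real^'n \<Rightarrow> real) set" where
  "H10 \<Omega> = {v \<in> H1 \<Omega>. \<exists>\<psi> :: nat \<Rightarrow> real^'n \<Rightarrow> real.
     (\<forall>n. test_function \<Omega> (\<psi> n)) \<and> (\<lambda>n. H1_norm \<Omega> (\<lambda>x. v x - \<psi> n x)) \<longlonglongrightarrow> 0}"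

text \<open>\<open>f \<in> H\<^sup>-\<^sup>1(\<Omega>)\<close>: a bounded linear functional on \<open>H\<^sup>1\<^sub>0(\<Omega>)\<close>; the duality pairing of \<open>f\<close> and \<open>v\<close> is
  the application \<open>f v\<close>. Boundedness makes \<open>f\<close> respect equality almost everywhere.\<close>

definition Hm1 :: "(real^'n) set \<Rightarrow> ((real^'n \<Rightarrow> real) \<Rightarrow> real) \<Rightarrow> bool" where
  "Hm1 \<Omega> f \<longleftrightarrow>
     (\<forall>v\<in>H10 \<Omega>. \<forall>w\<in>H10 \<Omega>. f (\<lambda>x. v x + w x) = f v + f w) \<and>
     (\<forall>c. \<forall>v\<in>H10 \<Omega>. f (\<lambda>x. c * v x) = c * f v) \<and>
     (\<exists>C. \<forall>v\<in>H10 \<Omega>. \<bar>f v\<bar> \<le> C * H1_norm \<Omega> v)"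

section \<open>The bilinear form of the problem\<close>

definition diffusion_tensor :: "(real^'n) set \<Rightarrow> real \<Rightarrow> (real^'n \<Rightarrow> real^'n^'n) \<Rightarrow> bool" where
  "diffusion_tensor \<Omega> d\<^sub>0 D \<longleftrightarrow>
     (\<forall>i j. Linf \<Omega> (\<lambda>x. D x $ i $ j)) \<and>
     (AE x in lebesgue_on \<Omega>. transpose (D x) = D x) \<and>
     d\<^sub>0 > 0 \<and> (AE x in lebesgue_on \<Omega>. \<forall>y. y \<bullet> (D x *v y) \<ge> d\<^sub>0 * (norm y)\<^sup>2)"

definition reaction_coefficient :: "(real^'n) set \<Rightarrow> real \<Rightarrow> (real^'n \<Rightarrow> real) \<Rightarrow> bool" where
  "reaction_coefficient \<Omega> \<mu>\<^sub>0 \<mu> \<longleftrightarrow>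
     Linf \<Omega> \<mu> \<and> \<mu>\<^sub>0 \<ge> 0 \<and> (AE x in lebesgue_on \<Omega>. \<mu> x \<ge> \<mu>\<^sub>0)"

definition a_form :: "(real^'n) set \<Rightarrow> (real^'n \<Rightarrow> real^'n^'n) \<Rightarrow> (real^'n \<Rightarrow> real) \<Rightarrow>
    (real^'n \<Rightarrow> real) \<Rightarrow> (real^'n \<Rightarrow> real) \<Rightarrow> real" where
  "a_form \<Omega> D \<mu> v w =
     (LINT x|lebesgue_on \<Omega>. (D x *v grad \<Omega> v x) \<bullet> grad \<Omega> w x) +
     (LINT x|lebesgue_on \<Omega>. \<mu> x * v x * w x)"

definition a_norm :: "(real^'n) set \<Rightarrow> (real^'n \<Rightarrow> real^'n^'n) \<Rightarrow> (real^'n \<Rightarrow> real) \<Rightarrow>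
    (real^'n \<Rightarrow> real) \<Rightarrow> real" where
  "a_norm \<Omega> D \<mu> v = sqrt (a_form \<Omega> D \<mu> v v)"

section \<open>Finite elements\<close>

text \<open>\<open>Cube\<close> stands for intervals, parallelograms and parallelepipeds, i.e. affine images of the
  unit cube.\<close>

datatype cell_shape = Simplex | Cube

fun reference_cell :: "cell_shape \<Rightarrow> (real^'n) set" where
  "reference_cell Simplex = convex hull (insert 0 Basis)"
| "reference_cell Cube = cbox 0 1"

definition cell_map :: "cell_shape \<Rightarrow> (real^'n) set \<Rightarrow> (real^'n \<Rightarrow> real^'n) \<Rightarrow> bool" where
  "cell_map s K T \<longleftrightarrow>
     (\<exists>A b. invertible A \<and> T = (\<lambda>x. A *v x + b)) \<and> K = T ` reference_cell s"

definition polynomials :: "('n::finite \<Rightarrow> nat) set \<Rightarrow> (real^'n \<Rightarrow> real) set" where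
  "polynomials E = {p. \<exists>c. p = (\<lambda>x. \<Sum>\<beta>\<in>E. c \<beta> * (\<Prod>i\<in>UNIV. x $ i ^ \<beta> i))}"

text \<open>\<open>\<bbbP>\<^sub>k(K)\<close> and \<open>\<rat>\<^sub>k(K)\<close>; in the latter, the affine maps of the unit cube onto \<open>K\<close> differ by
  symmetries of the cube, which preserve the polynomials of degree at most \<open>k\<close> in each variable, so
  one map satisfies the condition iff all do.\<close>

fun cell_polynomials :: "cell_shape \<Rightarrow> nat \<Rightarrow> (real^'n) set \<Rightarrow> (real^'n \<Rightarrow> real) set" where
  "cell_polynomials Simplex k K = polynomials {\<beta>. (\<Sum>i\<in>UNIV. \<beta> i) \<le> k}"
| "cell_polynomials Cube k K =
     {p. \<forall>T. cell_map Cube K T \<longrightarrow> p \<circ> T \<in> polynomials {\<beta>. \<forall>i. \<beta> i \<le> k}}"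

definition cell_nodes :: "cell_shape \<Rightarrow> nat \<Rightarrow> (real^'n) set \<Rightarrow> (real^'n) set" where
  "cell_nodes s k K = {T x |T x. cell_map s K T \<and> x \<in> reference_cell s \<and>
     (\<forall>i. \<exists>m::nat. x $ i = real m / real k)}"

definition conforming_partition ::
    "cell_shape \<Rightarrow> (real^'n) set \<Rightarrow> (real^'n) set set \<Rightarrow> bool" where
  "conforming_partition s \<Omega> P \<longleftrightarrow>
     finite P \<and> (\<forall>K\<in>P. \<exists>T. cell_map s K T) \<and> \<Union>P = closure \<Omega> \<and>
     (\<forall>K\<in>P. \<forall>K'\<in>P. (K \<inter> K') face_of K \<and> (K \<inter> K') face_of K')"

definition inball_diameter :: "(real^'n) set \<Rightarrow> real" where
  "inball_diameter K = Sup {2 * r |r. r \<ge> 0 \<and> (\<exists>x. cball x r \<subseteq> K)}"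

definition shape_regular :: "real \<Rightarrow> (real^'n) set set \<Rightarrow> bool" where
  "shape_regular \<sigma> P \<longleftrightarrow> (\<forall>K\<in>P. diameter K \<le> \<sigma> * inball_diameter K)"

definition fe_space ::
    "cell_shape \<Rightarrow> nat \<Rightarrow> (real^'n) set \<Rightarrow> (real^'n) set set \<Rightarrow> (real^'n \<Rightarrow> real) set" where
  "fe_space s k \<Omega> P = {v \<in> H10 \<Omega>. continuous_on \<Omega> v \<and>
     (\<forall>K\<in>P. \<exists>p\<in>cell_polynomials s k K. \<forall>x\<in>K \<inter> \<Omega>. v x = p x)}"

definition internal_nodes ::
    "cell_shape \<Rightarrow> nat \<Rightarrow> (real^'n) set \<Rightarrow> (real^'n) set set \<Rightarrow> (real^'n) set" where
  "internal_nodes s k \<Omega> P = (\<Union>K\<in>P. cell_nodes s k K) \<inter> \<Omega>"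

text \<open>The basis functions are indexed by the nodes themselves instead of by \<open>1, \<dots>, N\<close>. Their linear
  independence on \<open>\<Omega>\<close> is implied by the nodal values.\<close>

definition lagrange_basis :: "cell_shape \<Rightarrow> nat \<Rightarrow> (real^'n) set \<Rightarrow> (real^'n) set set \<Rightarrow>
    (real^'n \<Rightarrow> real^'n \<Rightarrow> real) \<Rightarrow> bool" where
  "lagrange_basis s k \<Omega> P \<phi> \<longleftrightarrow>
     (\<forall>x\<in>internal_nodes s k \<Omega> P. \<phi> x \<in> fe_space s k \<Omega> P \<and>
        (\<forall>y\<in>internal_nodes s k \<Omega> P. \<phi> x y = (if x = y then 1 else 0))) \<and>
     (\<forall>v\<in>fe_space s k \<Omega> P. \<forall>z\<in>\<Omega>. v z = (\<Sum>x\<in>internal_nodes s k \<Omega> P. v x * \<phi> x z))"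

definition cells_at :: "(real^'n) set set \<Rightarrow> real^'n \<Rightarrow> (real^'n) set set" where
  "cells_at P x = {K \<in> P. x \<in> K}"

definition mesh_function ::
    "cell_shape \<Rightarrow> (real^'n) set set \<Rightarrow> (real^'n \<Rightarrow> real) \<Rightarrow> bool" where
  "mesh_function s P \<hh> \<longleftrightarrow>
     continuous_on (\<Union>P) \<hh> \<and>
     (\<forall>K\<in>P. \<exists>p\<in>cell_polynomials s 1 K. \<forall>x\<in>K. \<hh> x = p x) \<and>
     (\<forall>K\<in>P. \<forall>x. x extreme_point_of K \<longrightarrow>
        \<hh> x = (\<Sum>K'\<in>cells_at P x. diameter K') / real (card (cells_at P x)))"

definition patch :: "(real^'n) set set \<Rightarrow> real^'n \<Rightarrow> (real^'n) set" where
  "patch P x = \<Union>{K \<in> P. K \<inter> \<Union>(cells_at P x) \<noteq> {}}"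

section \<open>Constrained and complementary parts\<close>

definition fe_space_plus :: "cell_shape \<Rightarrow> nat \<Rightarrow> (real^'n) set \<Rightarrow> (real^'n) set set \<Rightarrow> real \<Rightarrow>
    (real^'n \<Rightarrow> real) set" where
  "fe_space_plus s k \<Omega> P \<aa> =
     {v \<in> fe_space s k \<Omega> P. \<forall>x\<in>internal_nodes s k \<Omega> P. v x \<in> {0..\<aa>}}"

definition constrained_part :: "(real^'n) set \<Rightarrow> (real^'n \<Rightarrow> real^'n \<Rightarrow> real) \<Rightarrow> real \<Rightarrow>
    (real^'n \<Rightarrow> real) \<Rightarrow> real^'n \<Rightarrow> real" where
  "constrained_part X \<phi> \<aa> v = (\<lambda>z. \<Sum>x\<in>X. max 0 (min (v x) \<aa>) * \<phi> x z)"

definition complementary_part :: "(real^'n) set \<Rightarrow> (real^'n \<Rightarrow> real^'n \<Rightarrow> real) \<Rightarrow> real \<Rightarrow>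
    (real^'n \<Rightarrow> real) \<Rightarrow> real^'n \<Rightarrow> real" where
  "complementary_part X \<phi> \<aa> v = (\<lambda>z. v z - constrained_part X \<phi> \<aa> v z)"

section \<open>Stabilisation\<close>

text \<open>A norm on the space of matrices, not necessarily submultiplicative.\<close>

definition matrix_norm :: "(real^'n^'n \<Rightarrow> real) \<Rightarrow> bool" where
  "matrix_norm \<nu> \<longleftrightarrow>
     (\<forall>A. \<nu> A \<ge> 0) \<and> (\<forall>A. \<nu> A = 0 \<longleftrightarrow> A = 0) \<and>
     (\<forall>A B. \<nu> (A + B) \<le> \<nu> A + \<nu> B) \<and> (\<forall>c A. \<nu> (c *\<^sub>R A) = \<bar>c\<bar> * \<nu> A)"

text \<open>The exponent \<open>d - 2\<close> is negative for \<open>d = 1\<close>, hence the integer power. \<open>X\<close> is the set of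
  internal nodes.\<close>

definition s_form :: "(real^'n^'n \<Rightarrow> real) \<Rightarrow> (real^'n) set set \<Rightarrow> (real^'n) set \<Rightarrow>
    (real^'n \<Rightarrow> real) \<Rightarrow> (real^'n \<Rightarrow> real^'n^'n) \<Rightarrow> (real^'n \<Rightarrow> real) \<Rightarrow> real \<Rightarrow>
    (real^'n \<Rightarrow> real) \<Rightarrow> (real^'n \<Rightarrow> real) \<Rightarrow> real" where
  "s_form \<nu> P X \<hh> D \<mu> \<alpha> v w =
     \<alpha> * (\<Sum>x\<in>X. (linf_norm (patch P x) (\<lambda>y. \<nu> (D y)) * \<hh> x powi (int CARD('n) - 2) +
                 linf_norm (patch P x) \<mu> * \<hh> x ^ CARD('n)) * v x * w x)"

definition s_norm :: "(real^'n^'n \<Rightarrow> real) \<Rightarrow> (real^'n) set set \<Rightarrow> (real^'n) set \<Rightarrow>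
    (real^'n \<Rightarrow> real) \<Rightarrow> (real^'n \<Rightarrow> real^'n^'n) \<Rightarrow> (real^'n \<Rightarrow> real) \<Rightarrow> real \<Rightarrow>
    (real^'n \<Rightarrow> real) \<Rightarrow> real" where
  "s_norm \<nu> P X \<hh> D \<mu> \<alpha> v = sqrt (s_form \<nu> P X \<hh> D \<mu> \<alpha> v v)"

end

(* Since a(u, .) and a(uFEM, .) agree with f on V, the discrete equation says
   a(u - upos, v) = s(uneg, v) for all v in V (also with uFEM in place of u). The nodal values of upos
   are the projections of those of u_h to [0, a] and s is diagonal in the nodal values, so
   s(uneg, upos - v) >= 0 for v in Vplus: this is the variational inequality characterising upos as
   the a-projection of u onto Vplus. Testing with v = uneg, Cauchy-Schwarz and the norm equivalence
   give the bound on uneg.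

   The form a only makes sense as a bilinear form because weak gradients are unique almost everywhere,
   which requires enough test functions; and the weights of s are nonnegative because a (multi)affine
   function on a cell is nonnegative if it is so at the vertices. *)

theory Submission
  imports Defs
begin

section \<open>Smooth functions\<close>

text \<open>\<open>grad\<close> is an arbitrary choice among the weak gradients of a function, so
  even linearity of the form compares three unrelated representatives and can hold only off a null
  set. The definition of \<open>H10\<close> makes a second demand: it measures
  \<open>v - \<psi> n\<close> in \<open>H1_norm\<close>, which is defined through
  \<open>grad\<close> and says something only if this difference has a weak gradient. Hence the
  classical gradient of a test function must be shown to be a weak one, which is integration by
  parts without boundary term and rests on the vanishing integral of a partial derivative of a
  compactly supported function. Together these facts make \<open>H10\<close>, and with it the finite
  element space, closed under linear combinations. What remains is geometry in the seminorm of a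
  positive semidefinite form: expanding the square of \<open>u - v\<close> about \<open>upos\<close>
  leaves a cross term whose sign is decided node by node.\<close>

lemma classical_grad_nth:
  assumes "(\<psi> has_derivative \<psi>') (at x)"
  shows "classical_grad \<psi> x $ i = \<psi>' (axis i 1)"
  using frechet_derivative_at[OF assms] by (simp add: classical_grad_def)

lemma classical_grad_const [simp]: "classical_grad (\<lambda>_. c) x $ i = 0"
  by (simp add: classical_grad_nth[OF has_derivative_const])

lemma classical_grad_lincomb:
  assumes "v differentiable (at x)" "w differentiable (at x)"
  shows "classical_grad (\<lambda>x. v x + c * w x) x $ i = classical_grad v x $ i + c * classical_grad w x $ i"
proof -
  obtain v' w' where d: "(v has_derivative v') (at x)" "(w has_derivative w') (at x)"
    using assms unfolding differentiable_def by blast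
  have "((\<lambda>x. v x + c * w x) has_derivative (\<lambda>h. v' h + c * w' h)) (at x)"
    by (intro derivative_intros d)
  from classical_grad_nth[OF this] show ?thesis using d by (simp add: classical_grad_nth)
qed

lemma classical_grad_mult:
  assumes "v differentiable (at x)" "w differentiable (at x)"
  shows "classical_grad (\<lambda>x. v x * w x) x $ i = v x * classical_grad w x $ i + classical_grad v x $ i * w x"
proof -
  obtain v' w' where d: "(v has_derivative v') (at x)" "(w has_derivative w') (at x)"
    using assms unfolding differentiable_def by blast
  have "((\<lambda>x. v x * w x) has_derivative (\<lambda>h. v x * w' h + v' h * w x)) (at x)"
    by (intro derivative_intros d)
  from classical_grad_nth[OF this] show ?thesis using d by (simp add: classical_grad_nth)
qed

text \<open>The recursion passes to the partial derivatives, whereas the product rule leaves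
  undifferentiated factors, whose smoothness to the lower order has to be recovered.\<close>

lemma cont_diff_Suc_imp: "cont_diff (Suc m) \<psi> \<Longrightarrow> cont_diff m \<psi>"
proof (induction m arbitrary: \<psi>)
  case 0
  then show ?case
    by (auto intro!: differentiable_imp_continuous_on simp: differentiable_on_def
        intro: differentiable_at_withinI)
qed auto

lemma cont_diff_const: "cont_diff m (\<lambda>_. c)"
  by (induction m arbitrary: c) auto

lemma cont_diff_lincomb:
  "cont_diff m v \<Longrightarrow> cont_diff m w \<Longrightarrow> cont_diff m (\<lambda>x. v x + c * w x)"
proof (induction m arbitrary: v w)
  case 0
  then show ?case by (auto intro!: continuous_intros)
next
  case (Suc m)
  then have "(\<lambda>x. classical_grad (\<lambda>x. v x + c * w x) x $ i) =
      (\<lambda>x. classical_grad v x $ i + c * classical_grad w x $ i)" for i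
    by (auto simp: classical_grad_lincomb)
  with Suc show ?case by (auto intro!: derivative_intros)
qed

lemma cont_diff_mult:
  "cont_diff m v \<Longrightarrow> cont_diff m w \<Longrightarrow> cont_diff m (\<lambda>x. v x * w x)"
proof (induction m arbitrary: v w)
  case 0
  then show ?case by (auto intro!: continuous_intros)
next
  case (Suc m)
  \<comment> \<open>The factor 1 gives the sum the shape of
    \<open>cont_diff_lincomb\<close>.\<close>
  have eq: "(\<lambda>x. classical_grad (\<lambda>x. v x * w x) x $ i) =
      (\<lambda>x. v x * classical_grad w x $ i + 1 * (classical_grad v x $ i * w x))" for i
    using Suc.prems by (auto simp: classical_grad_mult)
  have "cont_diff m v" "cont_diff m w"
    using Suc.prems cont_diff_Suc_imp by blast+
  with Suc have "cont_diff m (\<lambda>x. v x * classical_grad w x $ i + 1 * (classical_grad v x $ i * w x))" for i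
    by (intro cont_diff_lincomb Suc.IH) auto
  then have "\<forall>i. cont_diff m (\<lambda>x. classical_grad (\<lambda>x. v x * w x) x $ i)"
    unfolding eq by blast
  with Suc.prems show ?case by simp
qed

lemma cont_diff_prod:
  assumes "finite I" "\<And>i. i \<in> I \<Longrightarrow> cont_diff m (v i)"
  shows "cont_diff m (\<lambda>x. \<Prod>i\<in>I. v i x)"
  using assms
proof (induction I rule: finite_induct)
  case empty
  then show ?case by (simp add: cont_diff_const)
next
  case (insert i I)
  then have "cont_diff m (\<lambda>x. v i x * (\<Prod>i\<in>I. v i x))"
    by (intro cont_diff_mult) simp_all
  with insert show ?case by simp
qed

section \<open>Smooth functions of compact support, built from exp(-1/t)\<close>

text \<open>The derivative of exp(-1/t)/t^m combines the same expressions for m + 1 and m + 2. The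
  exponent is a parameter so that the family is closed under differentiation up to linear
  combinations; the member m = 0 is the one that builds bumps.\<close>

definition flat_exp :: "nat \<Rightarrow> real \<Rightarrow> real" where
  "flat_exp m t = (if t > 0 then exp (- inverse t) / t ^ m else 0)"

text \<open>With s = 1/t the limit from the right is the decay of s^m / exp s at infinity.\<close>

lemma flat_exp_tendsto_0: "(flat_exp m \<longlongrightarrow> 0) (at 0)"
proof -
  have "((\<lambda>t. inverse t ^ m / exp (inverse t)) \<longlongrightarrow> (0::real)) (at_right 0)"
    by (rule filterlim_compose[OF tendsto_power_div_exp_0 filterlim_inverse_at_top_right])
  moreover have "\<forall>\<^sub>F t in at_right (0::real). inverse t ^ m / exp (inverse t) = flat_exp m t"
    unfolding eventually_at_right_field
    by (intro exI[of _ 1]) (auto simp: flat_exp_def exp_minus field_simps power_inverse)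
  ultimately have r: "(flat_exp m \<longlongrightarrow> 0) (at_right 0)"
    by (rule Lim_transform_eventually)
  have "\<forall>\<^sub>F t in at_left (0::real). 0 = flat_exp m t"
    unfolding eventually_at_left_field
    by (intro exI[of _ "-1"]) (auto simp: flat_exp_def)
  then have "(flat_exp m \<longlongrightarrow> 0) (at_left 0)"
    by (rule Lim_transform_eventually[OF tendsto_const])
  with r show ?thesis by (simp add: filterlim_split_at)
qed

lemma flat_exp_has_derivative:
  "(flat_exp m has_real_derivative flat_exp (Suc (Suc m)) t - real m * flat_exp (Suc m) t) (at t)"
proof -
  consider "t > 0" | "t < 0" | "t = 0" by linarith
  then show ?thesis
  proof cases
    case 1
    have "((\<lambda>t. exp (- inverse t) / t ^ m) has_real_derivative
        flat_exp (Suc (Suc m)) t - real m * flat_exp (Suc m) t) (at t)"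
    proof (cases m)
      case 0
      then show ?thesis using 1
        by (auto intro!: derivative_eq_intros simp: flat_exp_def field_simps)
    next
      case (Suc l)
      have "((\<lambda>t. t ^ m) has_real_derivative real m * t ^ l) (at t)"
        using DERIV_pow[of m t] by (simp add: Suc)
      moreover have "((\<lambda>t. exp (- inverse t)) has_real_derivative exp (- inverse t) * inverse (t\<^sup>2)) (at t)"
        using 1 by (auto intro!: derivative_eq_intros simp: power2_eq_square)
      ultimately have "((\<lambda>t. exp (- inverse t) / t ^ m) has_real_derivative
        (exp (- inverse t) * inverse (t\<^sup>2) * t ^ m - exp (- inverse t) * (real m * t ^ l)) / (t ^ m * t ^ m)) (at t)"
        using 1 by (intro DERIV_divide) auto
      also have "(exp (- inverse t) * inverse (t\<^sup>2) * t ^ m - exp (- inverse t) * (real m * t ^ l)) / (t ^ m * t ^ m) =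
        flat_exp (Suc (Suc m)) t - real m * flat_exp (Suc m) t"
      proof -
        \<comment> \<open>The power t^l is abstracted to b, so that only an identity of rational
          expressions remains.\<close>
        have "(e * inverse (t\<^sup>2) * (t * b) - e * (r * b)) / ((t * b) * (t * b)) =
          e / (t * (t * (t * b))) - r * (e / (t * (t * b)))" if "b > 0" for e b r :: real
          using 1 that by (simp add: field_simps power2_eq_square)
        from this[of "t ^ l"] 1 show ?thesis by (simp add: Suc flat_exp_def)
      qed
      finally show ?thesis .
    qed
    then show ?thesis
      by (rule has_field_derivative_transform_within_open[where S="{0<..}"])
        (use 1 in \<open>auto simp: flat_exp_def\<close>)
  next
    case 2
    have "((\<lambda>t. 0) has_real_derivative flat_exp (Suc (Suc m)) t - real m * flat_exp (Suc m) t) (at t)"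
      using 2 by (auto simp: flat_exp_def)
    then show ?thesis
      by (rule has_field_derivative_transform_within_open[where S="{..<0}"])
        (use 2 in \<open>auto simp: flat_exp_def\<close>)
  next
    case 3
    \<comment> \<open>Dividing by y only raises the exponent, so the derivative at 0 is the limit
      already computed. At y = 0 both sides are 0, on the left by the convention for
      division.\<close>
    have "(flat_exp m y - flat_exp m 0) / (y - 0) = flat_exp (Suc m) y" for y
      by (auto simp: flat_exp_def)
    then have "(flat_exp m has_real_derivative 0) (at 0)"
      unfolding has_field_derivative_iff by (simp add: flat_exp_tendsto_0)
    then show ?thesis using 3 by (simp add: flat_exp_def)
  qed
qed

text \<open>The induction keeps m arbitrary because a derivative replaces it by m + 1 and m + 2. The
  affine argument covers both the increasing and the decreasing factors of
  \<open>bump\<close>.\<close>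

lemma cont_diff_flat_exp:
  fixes i :: "'n::finite"
  shows "cont_diff n (\<lambda>x::real^'n. flat_exp m (c * x $ i + e))"
proof (induction n arbitrary: m)
  case 0
  have "isCont (flat_exp m) t" for t
    using flat_exp_has_derivative by (rule DERIV_isCont)
  then have "continuous_on UNIV (flat_exp m)"
    by (simp add: continuous_at_imp_continuous_on)
  then have "continuous_on UNIV (\<lambda>x::real^'n. flat_exp m (c * x $ i + e))"
    by (rule continuous_on_compose2) (intro continuous_intros subset_UNIV)+
  then show ?case by simp
next
  case (Suc n)
  have d: "((\<lambda>x::real^'n. flat_exp m (c * x $ i + e)) has_derivative
      (\<lambda>h. (flat_exp (Suc (Suc m)) (c * x $ i + e) - real m * flat_exp (Suc m) (c * x $ i + e)) * (c * h $ i)))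
      (at x)" for x
  proof -
    have "((\<lambda>x. x $ i) has_derivative (\<lambda>h. h $ i)) (at x)"
      by (rule bounded_linear_imp_has_derivative[OF bounded_linear_vec_nth])
    then have "((\<lambda>x. c * x $ i + e) has_derivative (\<lambda>h. c * h $ i)) (at x)"
      by (rule has_derivative_add_const[OF has_derivative_mult_right])
    from has_derivative_compose[OF this flat_exp_has_derivative[unfolded has_field_derivative_def]]
    show ?thesis .
  qed
  have "cont_diff n (\<lambda>x. classical_grad (\<lambda>x. flat_exp m (c * x $ i + e)) x $ j)" for j
  proof (cases "j = i")
    case True
    have "(\<lambda>x. classical_grad (\<lambda>x. flat_exp m (c * x $ i + e)) x $ j) =
      (\<lambda>x. 0 + c * (flat_exp (Suc (Suc m)) (c * x $ i + e) + (- real m) * flat_exp (Suc m) (c * x $ i + e)))"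
      by (simp add: True classical_grad_nth[OF d] axis_def mult.commute)
    moreover have "cont_diff n \<dots>"
      by (rule cont_diff_lincomb[OF cont_diff_const cont_diff_lincomb[OF Suc.IH Suc.IH]])
    ultimately show ?thesis by simp
  next
    case False
    then have "(\<lambda>x. classical_grad (\<lambda>x. flat_exp m (c * x $ i + e)) x $ j) = (\<lambda>x. 0)"
      by (auto simp: classical_grad_nth[OF d] axis_def)
    then show ?thesis by (simp add: cont_diff_const)
  qed
  moreover have "(\<lambda>x. flat_exp m (c * x $ i + e)) differentiable (at x)" for x
    using d unfolding differentiable_def by blast
  ultimately show ?case by simp
qed

text \<open>Spares the computation of exact supports: a compact set is closed, so as soon as it
  contains the points where \<psi> is nonzero it contains their closure.\<close>

lemma test_function_subset:
  assumes "\<And>m. cont_diff m \<psi>" "{x. \<psi> x \<noteq> 0} \<subseteq> S" "compact S" "S \<subseteq> \<Omega>"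
  shows "test_function \<Omega> \<psi>"
proof -
  have "closure {x. \<psi> x \<noteq> 0} \<subseteq> S"
    by (rule closure_minimal[OF assms(2) compact_imp_closed[OF assms(3)]])
  moreover have "compact (closure {x. \<psi> x \<noteq> 0})"
    unfolding compact_closure by (rule bounded_subset[OF compact_imp_bounded[OF assms(3)] assms(2)])
  ultimately show ?thesis using assms(1,4) by (simp add: test_function_def)
qed

lemma test_function_lincomb:
  assumes "test_function \<Omega> \<psi>" "test_function \<Omega> \<xi>"
  shows "test_function \<Omega> (\<lambda>x. \<psi> x + c * \<xi> x)"
proof (rule test_function_subset)
  show "cont_diff m (\<lambda>x. \<psi> x + c * \<xi> x)" for m
    using assms unfolding test_function_def by (simp add: cont_diff_lincomb)
  show "{x. \<psi> x + c * \<xi> x \<noteq> 0} \<subseteq> closure {x. \<psi> x \<noteq> 0} \<union> closure {x. \<xi> x \<noteq> 0}"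
  proof (rule subsetI)
    fix x assume "x \<in> {x. \<psi> x + c * \<xi> x \<noteq> 0}"
    then have "x \<in> {x. \<psi> x \<noteq> 0} \<or> x \<in> {x. \<xi> x \<noteq> 0}" by auto
    then show "x \<in> closure {x. \<psi> x \<noteq> 0} \<union> closure {x. \<xi> x \<noteq> 0}"
      by (elim disjE) (simp_all only: Un_iff closure_subset[THEN subsetD] simp_thms)
  qed
  show "compact (closure {x. \<psi> x \<noteq> 0} \<union> closure {x. \<xi> x \<noteq> 0})"
    and "closure {x. \<psi> x \<noteq> 0} \<union> closure {x. \<xi> x \<noteq> 0} \<subseteq> \<Omega>"
    using assms by (simp_all add: test_function_def compact_Un)
qed

text \<open>For n > 0 the product is positive exactly on the open box. The slope n drives each
  factor to 1 there while values never exceed 1, so the indicator of the box is approximated from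
  below.\<close>

definition bump :: "nat \<Rightarrow> real^'n \<Rightarrow> real^'n \<Rightarrow> real^'n \<Rightarrow> real" where
  "bump n p q x = (\<Prod>i\<in>UNIV. flat_exp 0 (real n * (x $ i - p $ i)) * flat_exp 0 (real n * (q $ i - x $ i)))"

lemma test_function_bump:
  assumes "cbox p q \<subseteq> \<Omega>"
  shows "test_function \<Omega> (bump n p q)"
proof (rule test_function_subset[OF _ _ compact_cbox assms])
  have "bump n p q = (\<lambda>x. \<Prod>i\<in>UNIV. flat_exp 0 (real n * x $ i + (- (real n * p $ i))) *
     flat_exp 0 (- real n * x $ i + real n * q $ i))"
    by (simp add: bump_def[abs_def] right_diff_distrib)
  then show "cont_diff m (bump n p q)" for m
    by (simp only:) (rule cont_diff_prod[OF finite cont_diff_mult[OF cont_diff_flat_exp cont_diff_flat_exp]])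
  show "{x. bump n p q x \<noteq> 0} \<subseteq> cbox p q"
  proof (rule subsetI)
    fix x assume "x \<in> {x. bump n p q x \<noteq> 0}"
    then have "flat_exp 0 (real n * (x $ i - p $ i)) \<noteq> 0" "flat_exp 0 (real n * (q $ i - x $ i)) \<noteq> 0" for i
      by (auto simp: bump_def)
    then have "real n * (x $ i - p $ i) > 0" "real n * (q $ i - x $ i) > 0" for i
      unfolding flat_exp_def by metis+
    then have "p $ i \<le> x $ i" "x $ i \<le> q $ i" for i
      by (simp_all add: zero_less_mult_iff less_imp_le)
    then show "x \<in> cbox p q" by (simp add: mem_box_cart)
  qed
qed

lemma flat_exp_0_bounds: "0 \<le> flat_exp 0 t" "flat_exp 0 t \<le> 1"
  by (auto simp: flat_exp_def)

lemma abs_bump_le: "\<bar>bump n p q x\<bar> \<le> 1"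
  unfolding bump_def abs_prod abs_mult
  by (intro prod_le_1 conjI mult_le_one) (auto simp: flat_exp_0_bounds)

lemma flat_exp_0_tendsto: "(\<lambda>n. flat_exp 0 (real n * t)) \<longlonglongrightarrow> (if t > 0 then 1 else 0)"
proof (cases "t > 0")
  case True
  have "(\<lambda>n. exp (- (inverse (real n) * inverse t))) \<longlonglongrightarrow> exp (- (0 * inverse t))"
    by (intro tendsto_intros lim_inverse_n)
  \<comment> \<open>The equation fails at n = 0, where the left side is exp 0 = 1 and the right side
    is 0.\<close>
  moreover have "\<forall>\<^sub>F n in sequentially. exp (- (inverse (real n) * inverse t)) = flat_exp 0 (real n * t)"
    using eventually_gt_at_top[of 0]
    by eventually_elim (use True in \<open>auto simp: flat_exp_def zero_less_mult_iff\<close>)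
  ultimately show ?thesis
    using True Lim_transform_eventually by fastforce
qed (auto simp: flat_exp_def zero_less_mult_iff)

lemma bump_tendsto: "(\<lambda>n. bump n p q x) \<longlonglongrightarrow> indicator (box p q) x"
proof -
  have "(\<lambda>n. bump n p q x) \<longlonglongrightarrow>
      (\<Prod>i\<in>UNIV. (if x $ i - p $ i > 0 then 1 else 0) * (if q $ i - x $ i > 0 then 1 else 0))"
    unfolding bump_def by (rule tendsto_prod[OF tendsto_mult[OF flat_exp_0_tendsto flat_exp_0_tendsto]])
  also have "(\<Prod>i\<in>UNIV. (if x $ i - p $ i > 0 then 1 else 0) * (if q $ i - x $ i > 0 then 1 else 0::real)) =
      indicator (box p q) x"
  proof (cases "x \<in> box p q")
    case False
    then obtain i where i: "\<not> (p $ i < x $ i \<and> x $ i < q $ i)"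
      unfolding mem_box_cart by blast
    have "(\<Prod>i\<in>UNIV. (if x $ i - p $ i > 0 then 1 else 0) * (if q $ i - x $ i > 0 then 1 else 0::real)) = 0"
      by (rule prod_zero[OF finite bexI[of _ i]]) (use i in auto)
    with False show ?thesis by simp
  next
    case True
    then have "(if x $ i - p $ i > 0 then 1 else 0) * (if q $ i - x $ i > 0 then 1 else 0::real) = 1" for i
      by (simp add: mem_box_cart)
    with True show ?thesis by simp
  qed
  finally show ?thesis .
qed

section \<open>Test functions\<close>

lemma classical_grad_eq_0:
  assumes "x \<notin> closure {x. \<psi> x \<noteq> 0}"
  shows "classical_grad \<psi> x $ i = 0"
proof -
  have "(\<psi> has_derivative (\<lambda>h. 0)) (at x)"
  proof (rule has_derivative_transform_within_open[OF has_derivative_const])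
    show "open (- closure {x. \<psi> x \<noteq> 0})" by (rule open_Compl[OF closed_closure])
    show "0 = \<psi> y" if "y \<in> - closure {x. \<psi> x \<noteq> 0}" for y
      using that closure_subset[of "{x. \<psi> x \<noteq> 0}"] by auto
  qed (use assms in simp)
  from classical_grad_nth[OF this] show ?thesis .
qed

lemma test_function_classical_grad:
  assumes "test_function \<Omega> \<psi>"
  shows "test_function \<Omega> (\<lambda>x. classical_grad \<psi> x $ i)"
proof (rule test_function_subset)
  have "cont_diff (Suc m) \<psi>" for m
    using assms by (simp only: test_function_def)
  then show "cont_diff m (\<lambda>x. classical_grad \<psi> x $ i)" for m
    by simp
  show "{x. classical_grad \<psi> x $ i \<noteq> 0} \<subseteq> closure {x. \<psi> x \<noteq> 0}"
    using classical_grad_eq_0 by blast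
qed (use assms in \<open>simp_all add: test_function_def\<close>)

lemma test_function_mult:
  assumes "test_function \<Omega> \<psi>" "test_function \<Omega> \<xi>"
  shows "test_function \<Omega> (\<lambda>x. \<psi> x * \<xi> x)"
proof (rule test_function_subset)
  show "cont_diff m (\<lambda>x. \<psi> x * \<xi> x)" for m
    using assms by (simp add: test_function_def cont_diff_mult)
  show "{x. \<psi> x * \<xi> x \<noteq> 0} \<subseteq> closure {x. \<psi> x \<noteq> 0}"
    by (rule order_trans[OF _ closure_subset]) auto
qed (use assms in \<open>simp_all add: test_function_def\<close>)

lemma test_function_differentiable: "test_function \<Omega> \<psi> \<Longrightarrow> \<psi> differentiable (at x)"
  by (metis cont_diff.simps(2) test_function_def)

lemma test_function_continuous: "test_function \<Omega> \<psi> \<Longrightarrow> continuous_on S \<psi>"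
  by (meson continuous_on_subset subset_UNIV cont_diff.simps(1) test_function_def)

lemma test_function_eq_0:
  assumes "test_function \<Omega> \<psi>" "x \<notin> \<Omega>"
  shows "\<psi> x = 0"
  using assms closure_subset[of "{x. \<psi> x \<noteq> 0}"] by (auto simp: test_function_def)

lemma test_function_bounds:
  assumes "test_function \<Omega> \<psi>"
  obtains C R where "\<And>x. \<bar>\<psi> x\<bar> \<le> C" "\<And>x. R < norm x \<Longrightarrow> \<psi> x = 0" 
proof -
  let ?K = "closure {x. \<psi> x \<noteq> 0}"
  have K: "compact ?K" using assms by (simp add: test_function_def)
  then have "bounded (\<psi> ` ?K)"
    by (rule compact_imp_bounded[OF compact_continuous_image[OF test_function_continuous[OF assms]]])
  then obtain C where C: "C > 0" "\<And>x. x \<in> ?K \<Longrightarrow> \<bar>\<psi> x\<bar> \<le> C"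
    by (auto simp: bounded_pos)
  obtain R where R: "\<And>x. x \<in> ?K \<Longrightarrow> norm x \<le> R"
    using compact_imp_bounded[OF K] by (auto simp: bounded_iff)
  have z: "\<psi> x = 0" if "x \<notin> ?K" for x
    using that closure_subset[of "{x. \<psi> x \<noteq> 0}"] by auto
  show thesis
  proof
    show "\<bar>\<psi> x\<bar> \<le> C" for x using C z[of x] by (cases "x \<in> ?K") auto
    show "\<psi> x = 0" if "R < norm x" for x using that R[of x] z[of x] by fastforce
  qed
qed

text \<open>On a coordinate line the partial derivative is an ordinary one, to which the mean value
  theorem and limits of difference quotients apply.\<close>

lemma test_function_line_derivative:
  assumes "test_function \<Omega> \<psi>"
  shows "((\<lambda>t. \<psi> (x + t *\<^sub>R axis i 1)) has_real_derivative
    classical_grad \<psi> (x + t *\<^sub>R axis i 1) $ i) (at t)"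
proof -
  let ?y = "x + t *\<^sub>R axis i 1"
  obtain \<psi>' where d: "(\<psi> has_derivative \<psi>') (at ?y)"
    using test_function_differentiable[OF assms] unfolding differentiable_def by blast
  have "((\<lambda>t. x + t *\<^sub>R axis i 1) has_derivative (\<lambda>h. h *\<^sub>R axis i (1::real))) (at t)"
    by (rule derivative_eq_intros refl | simp)+
  from has_derivative_compose[OF this d]
  have "((\<lambda>t. \<psi> (x + t *\<^sub>R axis i 1)) has_derivative (\<lambda>h. \<psi>' (h *\<^sub>R axis i 1))) (at t)" .
  moreover have "(\<lambda>h. \<psi>' (h *\<^sub>R axis i 1)) = (*) (\<psi>' (axis i 1))"
    using linear_cmul[OF has_derivative_linear[OF d]] by (auto simp: mult.commute)
  ultimately show ?thesis
    by (simp add: has_field_derivative_def classical_grad_nth[OF d])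
qed

lemma test_function_integrable_lborel:
  assumes "test_function \<Omega> \<psi>"
  shows "integrable lborel \<psi>"
proof -
  obtain C R where CR: "\<And>x. \<bar>\<psi> x\<bar> \<le> C" "\<And>x. R < norm x \<Longrightarrow> \<psi> x = 0"
    using test_function_bounds[OF assms] by blast
  show ?thesis
  proof (rule Bochner_Integration.integrable_bound)
    show "integrable lborel (\<lambda>x. indicator (cball 0 R) x *\<^sub>R C)"
      by (intro integrable_scaleR_left integrable_real_indicator emeasure_lborel_cball_finite) simp 
    show "\<psi> \<in> borel_measurable lborel"
      using test_function_continuous[OF assms] by (simp add: borel_measurable_continuous_onI)
    show "AE x in lborel. norm (\<psi> x) \<le> norm (indicator (cball 0 R) x *\<^sub>R C)"
    proof (rule AE_I2)
      fix x show "norm (\<psi> x) \<le> norm (indicator (cball 0 R) x *\<^sub>R C)"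
        using CR(1)[of x] CR(2)[of x] by (auto simp: indicator_def)
    qed
  qed
qed

text \<open>The difference quotients of \<open>\<psi>\<close> have integral zero because Lebesgue measure is translation
  invariant, and they converge to the partial derivative under a common integrable bound.\<close>

lemma integral_classical_grad_lborel:
  assumes "test_function \<Omega> \<psi>"
  shows "(LINT x|lborel. classical_grad \<psi> x $ i) = 0"
proof -
  let ?e = "axis i (1::real)"
  let ?d = "\<lambda>x. classical_grad \<psi> x $ i"
  define t where "t n = inverse (real (Suc n))" for n
  define q where "q n x = (\<psi> (x + t n *\<^sub>R ?e) - \<psi> x) / t n" for n x
  have t: "t n > 0" "t n \<le> 1" for n by (auto simp: t_def field_simps)
  note d = test_function_classical_grad[OF assms]
  have meas: "\<psi> \<in> borel_measurable borel" "?d \<in> borel_measurable borel"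
    by (rule borel_measurable_continuous_onI[OF test_function_continuous[OF assms]],
        rule borel_measurable_continuous_onI[OF test_function_continuous[OF d]])
  obtain C where C: "\<And>x. \<bar>?d x\<bar> \<le> C"
    using test_function_bounds[OF d] by blast
  obtain R where R: "\<And>x. R < norm x \<Longrightarrow> \<psi> x = 0"
    using test_function_bounds[OF assms] by blast
  have int: "integrable lborel \<psi>"
    by (rule test_function_integrable_lborel[OF assms])
  have shift: "integrable lborel (\<lambda>x. \<psi> (x + h))" "(LINT x|lborel. \<psi> (x + h)) = (LINT x|lborel. \<psi> x)" for h
  proof -
    have m: "(+) h \<in> measurable lborel borel" by simp
    have "integrable (distr lborel borel ((+) h)) \<psi>" using int by (simp add: lborel_distr_plus)
    then show "integrable lborel (\<lambda>x. \<psi> (x + h))"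
      by (subst (asm) integrable_distr_eq[OF m]) (simp_all add: meas add.commute)
    have "(LINT x|lborel. \<psi> x) = (LINT x|distr lborel borel ((+) h). \<psi> x)"
      by (simp add: lborel_distr_plus)
    also have "\<dots> = (LINT x|lborel. \<psi> (h + x))"
      by (rule integral_distr[OF m]) (simp add: meas)
    finally show "(LINT x|lborel. \<psi> (x + h)) = (LINT x|lborel. \<psi> x)"
      by (simp add: add.commute)
  qed
  have bound: "\<bar>q n x\<bar> \<le> C" for n x
  proof -
    have "\<exists>z. z > 0 \<and> z < t n \<and> \<psi> (x + t n *\<^sub>R ?e) - \<psi> (x + 0 *\<^sub>R ?e) = (t n - 0) * ?d (x + z *\<^sub>R ?e)"
      using test_function_line_derivative[OF assms] by (intro MVT2 t)
    then obtain z where "\<psi> (x + t n *\<^sub>R ?e) - \<psi> x = t n * ?d (x + z *\<^sub>R ?e)" by auto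
    then have "q n x = ?d (x + z *\<^sub>R ?e)" using t[of n] by (simp add: q_def)
    then show ?thesis using C by simp
  qed
  have "(\<lambda>n. LINT x|lborel. q n x) \<longlonglongrightarrow> (LINT x|lborel. ?d x)"
  proof (rule integral_dominated_convergence)
    show "?d \<in> borel_measurable lborel" using meas by simp
    show "q n \<in> borel_measurable lborel" for n
      unfolding q_def[abs_def] using meas by measurable
    \<comment> \<open>Since \<open>t n\<close> is at most 1, for x outside the ball of radius R + 1
      both points of the difference quotient lie where \<psi> vanishes.\<close>
    show "integrable lborel (\<lambda>x. indicator (cball 0 (R + 1)) x *\<^sub>R C)"
      by (intro integrable_scaleR_left integrable_real_indicator emeasure_lborel_cball_finite) simp
    show "AE x in lborel. (\<lambda>n. q n x) \<longlonglongrightarrow> ?d x"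
    proof (rule AE_I2)
      fix x
      have "((\<lambda>h. (\<psi> (x + h *\<^sub>R ?e) - \<psi> x) / h) \<longlongrightarrow> ?d x) (at 0)"
        using test_function_line_derivative[OF assms, of x i 0]
        by (simp add: has_field_derivative_iff)
      moreover have "filterlim t (at 0) sequentially"
        unfolding t_def[abs_def]
        by (rule filterlim_atI[OF LIMSEQ_inverse_real_of_nat]) simp
      ultimately show "(\<lambda>n. q n x) \<longlonglongrightarrow> ?d x"
        unfolding q_def by (rule filterlim_compose)
    qed
    show "AE x in lborel. norm (q n x) \<le> indicator (cball 0 (R + 1)) x *\<^sub>R C" for n
    proof (rule AE_I2)
      fix x
      show "norm (q n x) \<le> indicator (cball 0 (R + 1)) x *\<^sub>R C"
      proof (cases "x \<in> cball 0 (R + 1)")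
        case False
        have "norm x \<le> norm (x + t n *\<^sub>R ?e) + norm (t n *\<^sub>R ?e)"
          by (metis add_diff_cancel_right' norm_triangle_ineq4)
        then have "R < norm (x + t n *\<^sub>R ?e)" "R < norm x"
          using False t[of n] by (auto simp: norm_axis_1)
        then show ?thesis using False R by (simp add: q_def)
      qed (use bound[of n x] in simp)
    qed
  qed
  moreover have "(LINT x|lborel. q n x) = 0" for n
    unfolding q_def by (simp add: shift int)
  ultimately show ?thesis
    by (simp add: LIMSEQ_const_iff)
qed

text \<open>Carries the vanishing integral, proved for the translation invariant measure on the
  whole space, over to the measure of the Sobolev spaces.\<close>

lemma integral_lebesgue_on_test_function:
  assumes "test_function \<Omega> \<psi>" "open \<Omega>"
  shows "(LINT x|lebesgue_on \<Omega>. \<psi> x) = (LINT x|lborel. \<psi> x)"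
proof -
  have "(LINT x|lebesgue_on \<Omega>. \<psi> x) = (LINT x|lebesgue. (if x \<in> \<Omega> then \<psi> x else 0))"
    using assms(2) by (intro Lebesgue_Measure.integral_restrict_UNIV[symmetric] sets_completionI_sets) simp
  also have "(\<lambda>x. if x \<in> \<Omega> then \<psi> x else 0) = \<psi>"
    using test_function_eq_0[OF assms(1)] by auto
  also have "(LINT x|lebesgue. \<psi> x) = (LINT x|lborel. \<psi> x)"
    using test_function_continuous[OF assms(1)]
    by (intro integral_completion) (simp add: borel_measurable_continuous_onI)
  finally show ?thesis .
qed

section \<open>Square integrable functions\<close>

lemma L2_measurable: "L2 \<Omega> v \<Longrightarrow> v \<in> borel_measurable (lebesgue_on \<Omega>)"
  by (simp add: L2_def)

lemma L2_square_integrable: "L2 \<Omega> v \<Longrightarrow> integrable (lebesgue_on \<Omega>) (\<lambda>x. (norm (v x))\<^sup>2)"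
  by (simp add: L2_def)

lemma integrable_inner_L2:
  assumes "L2 \<Omega> v" "L2 \<Omega> w"
  shows "integrable (lebesgue_on \<Omega>) (\<lambda>x. v x \<bullet> w x)"
proof (rule Bochner_Integration.integrable_bound)
  show "integrable (lebesgue_on \<Omega>) (\<lambda>x. (norm (v x))\<^sup>2 + (norm (w x))\<^sup>2)"
    using assms by (intro Bochner_Integration.integrable_add L2_square_integrable)
  show "(\<lambda>x. v x \<bullet> w x) \<in> borel_measurable (lebesgue_on \<Omega>)"
    using assms by (intro borel_measurable_inner L2_measurable)
  show "AE x in lebesgue_on \<Omega>. norm (v x \<bullet> w x) \<le> norm ((norm (v x))\<^sup>2 + (norm (w x))\<^sup>2)"
  proof (rule AE_I2)
    fix x
    have "\<bar>v x \<bullet> w x\<bar> \<le> norm (v x) * norm (w x)" by (rule Cauchy_Schwarz_ineq2)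
    moreover have "2 * norm (v x) * norm (w x) \<le> (norm (v x))\<^sup>2 + (norm (w x))\<^sup>2"
      by (rule sum_squares_bound)
    moreover have "0 \<le> norm (v x) * norm (w x)" by simp
    ultimately show "norm (v x \<bullet> w x) \<le> norm ((norm (v x))\<^sup>2 + (norm (w x))\<^sup>2)"
      unfolding real_norm_def by arith
  qed
qed

lemma integrable_mult_L2:
  fixes v w :: "real^'n \<Rightarrow> real"
  shows "L2 \<Omega> v \<Longrightarrow> L2 \<Omega> w \<Longrightarrow> integrable (lebesgue_on \<Omega>) (\<lambda>x. v x * w x)"
  using integrable_inner_L2[of \<Omega> v w] by simp

lemma L2_lincomb:
  assumes "L2 \<Omega> v" "L2 \<Omega> w"
  shows "L2 \<Omega> (\<lambda>x. v x + c *\<^sub>R w x)"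
proof -
  have "(norm (v x + c *\<^sub>R w x))\<^sup>2 = (norm (v x))\<^sup>2 + 2 * c * (v x \<bullet> w x) + c\<^sup>2 * (norm (w x))\<^sup>2" for x
    unfolding power2_norm_eq_inner
    by (simp add: inner_simps inner_commute power2_eq_square distrib_left)
  then have "integrable (lebesgue_on \<Omega>) (\<lambda>x. (norm (v x + c *\<^sub>R w x))\<^sup>2)"
    using assms by (simp add: L2_square_integrable integrable_inner_L2)
  then show ?thesis
    unfolding L2_def
    by (intro conjI borel_measurable_add borel_measurable_scaleR borel_measurable_const
        L2_measurable[OF assms(1)] L2_measurable[OF assms(2)])
qed

lemma L2_lincomb_real:
  fixes v w :: "real^'n \<Rightarrow> real"
  shows "L2 \<Omega> v \<Longrightarrow> L2 \<Omega> w \<Longrightarrow> L2 \<Omega> (\<lambda>x. v x + c * w x)"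
  using L2_lincomb[of \<Omega> v w c] by simp

lemma L2_nth:
  assumes "L2 \<Omega> (g :: real^'n \<Rightarrow> real^'m)"
  shows "L2 \<Omega> (\<lambda>x. g x $ i)"
proof -
  have "(\<lambda>x. g x \<bullet> axis i 1) \<in> borel_measurable (lebesgue_on \<Omega>)"
    using L2_measurable[OF assms] by simp
  then have m: "(\<lambda>x. g x $ i) \<in> borel_measurable (lebesgue_on \<Omega>)"
    by (simp add: inner_axis)
  moreover have "integrable (lebesgue_on \<Omega>) (\<lambda>x. (norm (g x $ i))\<^sup>2)"
  proof (rule Bochner_Integration.integrable_bound[OF L2_square_integrable[OF assms]])
    show "(\<lambda>x. (norm (g x $ i))\<^sup>2) \<in> borel_measurable (lebesgue_on \<Omega>)"
      using m by simp
    show "AE x in lebesgue_on \<Omega>. norm ((norm (g x $ i))\<^sup>2) \<le> norm ((norm (g x))\<^sup>2)"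
    proof (rule AE_I2)
      fix x show "norm ((norm (g x $ i))\<^sup>2) \<le> norm ((norm (g x))\<^sup>2)"
        using power_mono[OF component_le_norm_cart[of "g x" i] abs_ge_zero, of 2] by simp
    qed
  qed
  ultimately show ?thesis by (simp add: L2_def)
qed

lemma finite_measure_lebesgue_on_open:
  "open \<Omega> \<Longrightarrow> bounded \<Omega> \<Longrightarrow> finite_measure (lebesgue_on \<Omega>)"
  by (intro finite_measure_lebesgue_on lmeasurable_open)

lemma L2_bounded:
  fixes v :: "real^'n \<Rightarrow> real"
  assumes "open \<Omega>" "bounded \<Omega>" "v \<in> borel_measurable (lebesgue_on \<Omega>)" "\<And>x. \<bar>v x\<bar> \<le> C"
  shows "L2 \<Omega> v"
proof -
  interpret finite_measure "lebesgue_on \<Omega>"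
    using assms by (intro finite_measure_lebesgue_on_open)
  have "AE x in lebesgue_on \<Omega>. norm ((norm (v x))\<^sup>2) \<le> C\<^sup>2"
    using power_mono[OF assms(4) abs_ge_zero, of _ 2] by simp
  then have "integrable (lebesgue_on \<Omega>) (\<lambda>x. (norm (v x))\<^sup>2)"
    using assms(3) by (intro integrable_const_bound) simp_all
  with assms(3) show ?thesis by (simp add: L2_def)
qed

text \<open>On a bounded domain the constant 1 is square integrable, and v = v * 1.\<close>

lemma L2_integrable:
  fixes v :: "real^'n \<Rightarrow> real"
  assumes "open \<Omega>" "bounded \<Omega>" "L2 \<Omega> v"
  shows "integrable (lebesgue_on \<Omega>) v"
  using integrable_mult_L2[OF assms(3) L2_bounded[OF assms(1,2), of "\<lambda>_. 1" 1]] by simp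

lemma L2_test_function:
  assumes "open \<Omega>" "bounded \<Omega>" "test_function \<Omega> \<psi>"
  shows "L2 \<Omega> \<psi>"
proof -
  obtain C where C: "\<And>x. \<bar>\<psi> x\<bar> \<le> C" using test_function_bounds[OF assms(3)] by metis
  have "\<psi> \<in> borel_measurable (lebesgue_on \<Omega>)"
    by (rule continuous_imp_measurable_on_sets_lebesgue[OF test_function_continuous[OF assms(3)]
        fmeasurableD[OF lmeasurable_open[OF assms(2,1)]]])
  from L2_bounded[OF assms(1,2) this C] show ?thesis .
qed

lemma integrable_Linf_mult:
  assumes "Linf \<Omega> g" "integrable (lebesgue_on \<Omega>) h"
  shows "integrable (lebesgue_on \<Omega>) (\<lambda>x. g x * h x)"
proof -
  obtain C where C: "AE x in lebesgue_on \<Omega>. \<bar>g x\<bar> \<le> C" and m: "g \<in> borel_measurable (lebesgue_on \<Omega>)"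
    using assms(1) by (auto simp: Linf_def)
  show ?thesis
  proof (rule Bochner_Integration.integrable_bound)
    show "integrable (lebesgue_on \<Omega>) (\<lambda>x. C * h x)" using assms(2) by simp
    show "(\<lambda>x. g x * h x) \<in> borel_measurable (lebesgue_on \<Omega>)" using m assms(2) by simp
    show "AE x in lebesgue_on \<Omega>. norm (g x * h x) \<le> norm (C * h x)"
      using C
    proof (eventually_elim)
      case (elim x)
      then have "\<bar>g x\<bar> \<le> \<bar>C\<bar>" by linarith
      then show ?case by (simp add: abs_mult mult_right_mono)
    qed
  qed
qed

section \<open>Weak gradients\<close>

lemma weak_gradient_lincomb:
  assumes "open \<Omega>" "bounded \<Omega>" "L2 \<Omega> v" "L2 \<Omega> w" "weak_gradient \<Omega> v g" "weak_gradient \<Omega> w h"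
  shows "weak_gradient \<Omega> (\<lambda>x. v x + c * w x) (\<lambda>x. g x + c *\<^sub>R h x)"
  unfolding weak_gradient_def
proof (intro conjI allI impI)
  have gh: "L2 \<Omega> g" "L2 \<Omega> h" using assms(5,6) by (simp_all add: weak_gradient_def)
  then show "L2 \<Omega> (\<lambda>x. g x + c *\<^sub>R h x)" by (rule L2_lincomb)
  fix \<psi> i assume \<psi>: "test_function \<Omega> \<psi>"
  note L = L2_test_function[OF assms(1,2) \<psi>]
    L2_test_function[OF assms(1,2) test_function_classical_grad[OF \<psi>]]
  have int: "integrable (lebesgue_on \<Omega>) (\<lambda>x. v x * classical_grad \<psi> x $ i)"
    "integrable (lebesgue_on \<Omega>) (\<lambda>x. w x * classical_grad \<psi> x $ i)"
    "integrable (lebesgue_on \<Omega>) (\<lambda>x. g x $ i * \<psi> x)"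
    "integrable (lebesgue_on \<Omega>) (\<lambda>x. h x $ i * \<psi> x)"
    by (intro integrable_mult_L2 L2_nth assms(3,4) gh L)+
  have "(LINT x|lebesgue_on \<Omega>. (v x + c * w x) * classical_grad \<psi> x $ i) =
    (LINT x|lebesgue_on \<Omega>. v x * classical_grad \<psi> x $ i) + c * (LINT x|lebesgue_on \<Omega>. w x * classical_grad \<psi> x $ i)"
    using int by (simp add: distrib_right mult.assoc)
  also have "\<dots> = - ((LINT x|lebesgue_on \<Omega>. g x $ i * \<psi> x) + c * (LINT x|lebesgue_on \<Omega>. h x $ i * \<psi> x))"
    using assms(5,6) \<psi> by (simp add: weak_gradient_def)
  also have "\<dots> = - (LINT x|lebesgue_on \<Omega>. (g x + c *\<^sub>R h x) $ i * \<psi> x)"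
    using int by (simp add: distrib_right mult.assoc)
  finally show "(LINT x|lebesgue_on \<Omega>. (v x + c * w x) * classical_grad \<psi> x $ i) =
    - (LINT x|lebesgue_on \<Omega>. (g x + c *\<^sub>R h x) $ i * \<psi> x)" .
qed

text \<open>Integration by parts: \<psi> * \<xi> is again a test function, so its partial derivative
  has integral zero, and the product rule splits that integral in two.\<close>

lemma weak_gradient_test_function:
  assumes "open \<Omega>" "bounded \<Omega>" "test_function \<Omega> \<psi>"
  shows "weak_gradient \<Omega> \<psi> (classical_grad \<psi>)"
  unfolding weak_gradient_def
proof (intro conjI allI impI)
  \<comment> \<open>Measurability and square integrability of the vector field are assembled from
    its components.\<close>
  have L: "L2 \<Omega> (\<lambda>x. classical_grad \<psi> x $ i)" for i
    using assms by (intro L2_test_function test_function_classical_grad)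
  have "classical_grad \<psi> = (\<lambda>x. \<Sum>i\<in>UNIV. classical_grad \<psi> x $ i *\<^sub>R axis i 1)"
  proof (rule ext)
    fix x show "classical_grad \<psi> x = (\<Sum>i\<in>UNIV. classical_grad \<psi> x $ i *\<^sub>R axis i 1)"
      using basis_expansion[of "classical_grad \<psi> x"] by (simp only: scalar_mult_eq_scaleR)
  qed
  moreover have "(\<lambda>x. \<Sum>i\<in>UNIV. classical_grad \<psi> x $ i *\<^sub>R (axis i 1 :: real^'a)) \<in> borel_measurable (lebesgue_on \<Omega>)"
    using L2_measurable[OF L] by simp
  moreover have "(norm (classical_grad \<psi> x))\<^sup>2 = (\<Sum>i\<in>UNIV. (norm (classical_grad \<psi> x $ i))\<^sup>2)" for x
    by (simp add: norm_vec_def L2_set_def sum_nonneg)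
  ultimately show "L2 \<Omega> (classical_grad \<psi>)"
    unfolding L2_def using L2_square_integrable[OF L] by (simp del: real_norm_def)
  fix \<xi> i assume \<xi>: "test_function \<Omega> \<xi>"
  let ?L = "lebesgue_on \<Omega>"
  have int: "integrable ?L (\<lambda>x. \<psi> x * classical_grad \<xi> x $ i)" "integrable ?L (\<lambda>x. classical_grad \<psi> x $ i * \<xi> x)"
    by (intro integrable_mult_L2 L2_test_function test_function_classical_grad assms \<xi>)+
  have p: "test_function \<Omega> (\<lambda>x. \<psi> x * \<xi> x)"
    by (rule test_function_mult[OF assms(3) \<xi>])
  have "(LINT x|?L. \<psi> x * classical_grad \<xi> x $ i) + (LINT x|?L. classical_grad \<psi> x $ i * \<xi> x) =
    (LINT x|?L. \<psi> x * classical_grad \<xi> x $ i + classical_grad \<psi> x $ i * \<xi> x)"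
    using int by simp
  also have "\<dots> = (LINT x|?L. classical_grad (\<lambda>x. \<psi> x * \<xi> x) x $ i)"
    by (simp add: classical_grad_mult test_function_differentiable[OF assms(3)] test_function_differentiable[OF \<xi>])
  also have "\<dots> = 0"
    using integral_lebesgue_on_test_function[OF test_function_classical_grad[OF p] assms(1)]
      integral_classical_grad_lborel[OF p] by simp
  finally show "(LINT x|?L. \<psi> x * classical_grad \<xi> x $ i) = - (LINT x|?L. classical_grad \<psi> x $ i * \<xi> x)"
    by simp
qed

text \<open>The bump functions of a box increase boundedly to its indicator, so \<open>g\<close> has integral zero over
  every box in \<open>\<Omega>\<close>, and it vanishes at its Lebesgue points.\<close>

lemma fundamental_lemma:
  fixes g :: "real^'n \<Rightarrow> real"
  assumes "open \<Omega>" "integrable (lebesgue_on \<Omega>) g"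
    and zero: "\<And>\<psi>. test_function \<Omega> \<psi> \<Longrightarrow> (LINT x|lebesgue_on \<Omega>. g x * \<psi> x) = 0"
  shows "AE x in lebesgue_on \<Omega>. g x = 0"
proof -
  have \<Omega>: "\<Omega> \<in> sets lebesgue" using assms(1) by (intro sets_completionI_sets) simp
  define G where "G x = (if x \<in> \<Omega> then g x else 0)" for x
  have G: "integrable lebesgue G"
    unfolding G_def[abs_def] using assms(2) by (subst Lebesgue_Measure.integrable_restrict_UNIV[OF \<Omega>])
  have abs: "G absolutely_integrable_on S" if "S \<in> sets lebesgue" for S
    unfolding set_integrable_def using that G by (rule integrable_mult_indicator)
  have box: "integral (cbox p q) G = 0" if "cbox p q \<subseteq> \<Omega>" for p q
  proof -
    have "(\<lambda>n. LINT x|lebesgue. bump n p q x * G x) \<longlonglongrightarrow> (LINT x|lebesgue. indicator (box p q) x * G x)"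
    proof (rule integral_dominated_convergence)
      show "integrable lebesgue (\<lambda>x. \<bar>G x\<bar>)" using G by simp
      show "(\<lambda>x. indicator (box p q) x * G x) \<in> borel_measurable lebesgue"
        using abs[of "box p q"] by (simp add: set_integrable_def)
      show "(\<lambda>x. bump n p q x * G x) \<in> borel_measurable lebesgue" for n
      proof -
        have "bump n p q \<in> borel_measurable lebesgue"
          using continuous_imp_measurable_on_sets_lebesgue[OF test_function_continuous[OF test_function_bump[OF that]], of UNIV] by simp
        with G show ?thesis by simp
      qed
      show "AE x in lebesgue. (\<lambda>n. bump n p q x * G x) \<longlonglongrightarrow> indicator (box p q) x * G x"
        by (intro AE_I2 tendsto_mult_right bump_tendsto)
      show "AE x in lebesgue. norm (bump n p q x * G x) \<le> \<bar>G x\<bar>" for n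
      proof (rule AE_I2)
        fix x show "norm (bump n p q x * G x) \<le> \<bar>G x\<bar>"
          using mult_right_mono[OF abs_bump_le[of n p q x] abs_ge_zero[of "G x"]] by (simp add: abs_mult)
      qed
    qed
    moreover have "(LINT x|lebesgue. bump n p q x * G x) = 0" for n
    proof -
      have "(LINT x|lebesgue. bump n p q x * G x) = (LINT x|lebesgue. (if x \<in> \<Omega> then g x * bump n p q x else 0))"
        by (rule Bochner_Integration.integral_cong) (auto simp: G_def)
      also have "\<dots> = (LINT x|lebesgue_on \<Omega>. g x * bump n p q x)"
        by (rule Lebesgue_Measure.integral_restrict_UNIV[OF \<Omega>])
      finally show ?thesis using zero[OF test_function_bump[OF that]] by simp
    qed
    ultimately have "(LINT x|lebesgue. indicator (box p q) x * G x) = 0"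
      by (simp add: LIMSEQ_const_iff)
    moreover have "(LINT x:box p q|lebesgue. G x) = integral (box p q) G"
      by (rule set_lebesgue_integral_eq_integral[OF abs]) simp
    ultimately show ?thesis
      by (simp add: set_lebesgue_integral_def integral_open_interval)
  qed
  \<comment> \<open>Lebesgue differentiation asks for integrability on every box, also on those that
    leave \<Omega>; this is why g was extended by zero.\<close>
  have "G integrable_on cbox a b" for a b
    by (rule set_lebesgue_integral_eq_integral(1)[OF abs]) simp
  \<comment> \<open>Off N, the value of G at x is the limit of its averages over cubes with lower
    corner x.\<close>
  then obtain N where N: "negligible N" and lim: "\<And>x e. \<lbrakk>x \<notin> N; 0 < e\<rbrakk> \<Longrightarrow>
      \<exists>d>0. \<forall>h. 0 < h \<and> h < d \<longrightarrow>
        norm (integral (cbox x (x + h *\<^sub>R One)) G /\<^sub>R h ^ DIM(real^'n) - G x) < e"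
    using integrable_ccontinuous_explicit by blast
  have g: "g x = 0" if "x \<in> \<Omega>" "x \<notin> N" for x
  proof (rule ccontr)
    assume "g x \<noteq> 0"
    then obtain d where d: "d > 0" "\<And>h. 0 < h \<Longrightarrow> h < d \<Longrightarrow>
        norm (integral (cbox x (x + h *\<^sub>R One)) G /\<^sub>R h ^ DIM(real^'n) - G x) < \<bar>g x\<bar>"
      using lim[OF \<open>x \<notin> N\<close>, of "\<bar>g x\<bar>"] by auto
    obtain e where e: "e > 0" "cball x e \<subseteq> \<Omega>"
      using assms(1) \<open>x \<in> \<Omega>\<close> open_contains_cball by blast
    \<comment> \<open>A point of the cube of edge h is within h * c of x, so h = e / c keeps the
      cube in the ball, and d / 2 keeps h below d. The added 1 makes c positive at once.\<close>
    define c where "c = norm (One :: real^'n) + 1"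
    have c: "c > 0" "norm (One :: real^'n) \<le> c" by (simp_all add: c_def add_nonneg_pos)
    define h where "h = min (d / 2) (e / c)"
    have h: "0 < h" "h < d" "h * c \<le> e"
      using d(1) e(1) c(1) by (auto simp: h_def min_def field_simps)
    have "cbox x (x + h *\<^sub>R One) \<subseteq> cball x e"
    proof
      fix y assume y: "y \<in> cbox x (x + h *\<^sub>R One)"
      have "norm (y - x) \<le> norm (h *\<^sub>R (One :: real^'n))"
        using y by (intro norm_le_componentwise) (auto simp: mem_box inner_simps)
      also have "\<dots> \<le> h * c" using h(1) c(2) by (simp add: mult_left_mono)
      finally show "y \<in> cball x e" using h(3) by (simp add: dist_norm norm_minus_commute)
    qed
    with e(2) have "integral (cbox x (x + h *\<^sub>R One)) G = 0" by (intro box) auto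
    \<comment> \<open>The average is 0, so the estimate would read |g x| < |g x|.\<close>
    with d(2)[OF h(1,2)] \<open>x \<in> \<Omega>\<close> show False by (simp add: G_def)
  qed
  have "AE x in lebesgue. x \<notin> N"
    using N by (intro AE_not_in) (simp add: negligible_iff_null_sets)
  then have "AE x in lebesgue. x \<in> \<Omega> \<longrightarrow> g x = 0"
    by eventually_elim (use g in blast)
  then show ?thesis
    using \<Omega> by (simp add: AE_restrict_space_iff)
qed

text \<open>Tested with \<psi>, the components of g and h give the same integral, that of v against
  a derivative of \<psi> up to sign. Boundedness of the domain turns their square integrability into
  the integrability that the fundamental lemma requires.\<close>

lemma weak_gradient_unique:
  assumes "open \<Omega>" "bounded \<Omega>" "weak_gradient \<Omega> v g" "weak_gradient \<Omega> v h"
  shows "AE x in lebesgue_on \<Omega>. g x = h x"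
proof -
  have "AE x in lebesgue_on \<Omega>. g x $ i - h x $ i = 0" for i
  proof (rule fundamental_lemma[OF assms(1)])
    have L: "L2 \<Omega> (\<lambda>x. g x $ i)" "L2 \<Omega> (\<lambda>x. h x $ i)"
      using assms(3,4) by (auto simp: weak_gradient_def intro: L2_nth)
    then show "integrable (lebesgue_on \<Omega>) (\<lambda>x. g x $ i - h x $ i)"
      using L2_integrable[OF assms(1,2)] by simp
    fix \<psi> assume \<psi>: "test_function \<Omega> \<psi>"
    have "integrable (lebesgue_on \<Omega>) (\<lambda>x. g x $ i * \<psi> x)" "integrable (lebesgue_on \<Omega>) (\<lambda>x. h x $ i * \<psi> x)"
      using L L2_test_function[OF assms(1,2) \<psi>] by (simp_all add: integrable_mult_L2)
    then show "(LINT x|lebesgue_on \<Omega>. (g x $ i - h x $ i) * \<psi> x) = 0"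
      using assms(3,4) \<psi> unfolding weak_gradient_def by (simp add: left_diff_distrib) 
  qed
  then have "AE x in lebesgue_on \<Omega>. \<forall>i. g x $ i - h x $ i = 0"
    by (simp add: AE_all_countable)
  then show ?thesis
    by eventually_elim (simp add: vec_eq_iff)
qed

section \<open>The spaces \<open>H\<^sup>1\<close> and \<open>H\<^sup>1\<^sub>0\<close>\<close>

lemma weak_gradient_grad: "v \<in> H1 \<Omega> \<Longrightarrow> weak_gradient \<Omega> v (grad \<Omega> v)"
  unfolding H1_def grad_def by (simp add: someI_ex)

lemma L2_H1: "v \<in> H1 \<Omega> \<Longrightarrow> L2 \<Omega> v"
  by (simp add: H1_def)

lemma L2_grad: "v \<in> H1 \<Omega> \<Longrightarrow> L2 \<Omega> (grad \<Omega> v)"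
  using weak_gradient_grad[of v \<Omega>] by (simp add: weak_gradient_def)

lemma H1_lincomb:
  assumes "open \<Omega>" "bounded \<Omega>" "v \<in> H1 \<Omega>" "w \<in> H1 \<Omega>"
  shows "(\<lambda>x. v x + c * w x) \<in> H1 \<Omega>"
  using weak_gradient_lincomb[OF assms(1,2) L2_H1[OF assms(3)] L2_H1[OF assms(4)]
      weak_gradient_grad[OF assms(3)] weak_gradient_grad[OF assms(4)], of c]
    L2_lincomb_real[OF L2_H1[OF assms(3)] L2_H1[OF assms(4)], of c]
  unfolding H1_def by blast

text \<open>The three gradients are chosen independently; uniqueness of weak gradients is what ties
  them together. All later linearity of the form and of norms comes from here.\<close>

lemma grad_lincomb:
  assumes "open \<Omega>" "bounded \<Omega>" "v \<in> H1 \<Omega>" "w \<in> H1 \<Omega>"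
  shows "AE x in lebesgue_on \<Omega>. grad \<Omega> (\<lambda>x. v x + c * w x) x = grad \<Omega> v x + c *\<^sub>R grad \<Omega> w x"
  by (rule weak_gradient_unique[OF assms(1,2) weak_gradient_grad[OF H1_lincomb[OF assms]]
        weak_gradient_lincomb[OF assms(1,2) L2_H1[OF assms(3)] L2_H1[OF assms(4)]
          weak_gradient_grad[OF assms(3)] weak_gradient_grad[OF assms(4)]]])

lemma test_function_H1:
  assumes "open \<Omega>" "bounded \<Omega>" "test_function \<Omega> \<psi>"
  shows "\<psi> \<in> H1 \<Omega>"
  using weak_gradient_test_function[OF assms] L2_test_function[OF assms] by (auto simp: H1_def)

text \<open>A crude substitute for the Minkowski inequality. The factor 2 is harmless because the
  bound serves only to show that norms tend to 0.\<close>

lemma integral_norm_lincomb_le: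
  fixes v w :: "real^'n \<Rightarrow> 'b::euclidean_space"
  assumes "L2 \<Omega> v" "L2 \<Omega> w"
  shows "(LINT x|lebesgue_on \<Omega>. (norm (v x + c *\<^sub>R w x))\<^sup>2) \<le>
    2 * (LINT x|lebesgue_on \<Omega>. (norm (v x))\<^sup>2) + 2 * c\<^sup>2 * (LINT x|lebesgue_on \<Omega>. (norm (w x))\<^sup>2)"
proof -
  let ?L = "lebesgue_on \<Omega>"
  have le: "(norm (v x + c *\<^sub>R w x))\<^sup>2 \<le> 2 * (norm (v x))\<^sup>2 + 2 * c\<^sup>2 * (norm (w x))\<^sup>2" for x
  proof -
    \<comment> \<open>The parallelogram law, of which the second square is then dropped.\<close>
    have "(norm (v x + c *\<^sub>R w x))\<^sup>2 + (norm (v x - c *\<^sub>R w x))\<^sup>2 =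
        2 * (norm (v x))\<^sup>2 + 2 * c\<^sup>2 * (norm (w x))\<^sup>2"
      unfolding power2_norm_eq_inner by (simp add: inner_simps inner_commute power2_eq_square)
    then show ?thesis using zero_le_power2[of "norm (v x - c *\<^sub>R w x)"] by linarith
  qed
  note int = L2_square_integrable[OF assms(1)] L2_square_integrable[OF assms(2)]
  have "(LINT x|?L. (norm (v x + c *\<^sub>R w x))\<^sup>2) \<le>
      (LINT x|?L. 2 * (norm (v x))\<^sup>2 + 2 * c\<^sup>2 * (norm (w x))\<^sup>2)"
    by (rule integral_mono[OF L2_square_integrable[OF L2_lincomb[OF assms]] _ le])
      (intro Bochner_Integration.integrable_add integrable_mult_right int)
  also have "\<dots> = 2 * (LINT x|?L. (norm (v x))\<^sup>2) + 2 * c\<^sup>2 * (LINT x|?L. (norm (w x))\<^sup>2)"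
    using int by simp
  finally show ?thesis .
qed

lemma H1_norm_nonneg: "H1_norm \<Omega> v \<ge> 0"
  by (simp add: H1_norm_def)

lemma H1_norm_lincomb_le:
  assumes "open \<Omega>" "bounded \<Omega>" "v \<in> H1 \<Omega>" "w \<in> H1 \<Omega>"
  shows "H1_norm \<Omega> (\<lambda>x. v x + c * w x) \<le> sqrt (2 * (H1_norm \<Omega> v)\<^sup>2 + 2 * c\<^sup>2 * (H1_norm \<Omega> w)\<^sup>2)"
proof -
  let ?L = "lebesgue_on \<Omega>" and ?z = "\<lambda>x. v x + c * w x"
  have sq: "(H1_norm \<Omega> u)\<^sup>2 = (LINT x|?L. (norm (u x))\<^sup>2) + (LINT x|?L. (norm (grad \<Omega> u x))\<^sup>2)" for u
    by (simp add: H1_norm_def)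
  have "(LINT x|?L. (norm (grad \<Omega> ?z x))\<^sup>2) = (LINT x|?L. (norm (grad \<Omega> v x + c *\<^sub>R grad \<Omega> w x))\<^sup>2)"
  proof (rule integral_cong_AE)
    show "AE x in ?L. (norm (grad \<Omega> ?z x))\<^sup>2 = (norm (grad \<Omega> v x + c *\<^sub>R grad \<Omega> w x))\<^sup>2"
      using grad_lincomb[OF assms, of c] by eventually_elim simp
    show "(\<lambda>x. (norm (grad \<Omega> ?z x))\<^sup>2) \<in> borel_measurable ?L"
      by (rule borel_measurable_integrable[OF L2_square_integrable[OF L2_grad[OF H1_lincomb[OF assms]]]])
    show "(\<lambda>x. (norm (grad \<Omega> v x + c *\<^sub>R grad \<Omega> w x))\<^sup>2) \<in> borel_measurable ?L"
      by (rule borel_measurable_integrable[OF L2_square_integrable[OF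
            L2_lincomb[OF L2_grad[OF assms(3)] L2_grad[OF assms(4)]]]])
  qed
  then have "(H1_norm \<Omega> ?z)\<^sup>2 \<le> 2 * (H1_norm \<Omega> v)\<^sup>2 + 2 * c\<^sup>2 * (H1_norm \<Omega> w)\<^sup>2"
    using integral_norm_lincomb_le[OF L2_H1[OF assms(3)] L2_H1[OF assms(4)], of c]
      integral_norm_lincomb_le[OF L2_grad[OF assms(3)] L2_grad[OF assms(4)], of c]
    unfolding sq distrib_left real_scaleR_def by linarith
  then show ?thesis by (rule real_le_rsqrt)
qed

lemma H10_H1: "v \<in> H10 \<Omega> \<Longrightarrow> v \<in> H1 \<Omega>"
  by (simp add: H10_def)

lemma H10_lincomb:
  assumes "open \<Omega>" "bounded \<Omega>" "v \<in> H10 \<Omega>" "w \<in> H10 \<Omega>"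
  shows "(\<lambda>x. v x + c * w x) \<in> H10 \<Omega>"
proof -
  obtain \<psi> where \<psi>: "\<And>n. test_function \<Omega> (\<psi> n)" "(\<lambda>n. H1_norm \<Omega> (\<lambda>x. v x - \<psi> n x)) \<longlonglongrightarrow> 0"
    using assms(3) by (auto simp: H10_def)
  obtain \<xi> where \<xi>: "\<And>n. test_function \<Omega> (\<xi> n)" "(\<lambda>n. H1_norm \<Omega> (\<lambda>x. w x - \<xi> n x)) \<longlonglongrightarrow> 0"
    using assms(4) by (auto simp: H10_def)
  \<comment> \<open>The norm estimate applies only to members of \<open>H1\<close>; here the weak
    differentiability of test functions is used.\<close>
  have diff: "(\<lambda>x. v x - \<psi> n x) \<in> H1 \<Omega>" "(\<lambda>x. w x - \<xi> n x) \<in> H1 \<Omega>" for n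
    using H1_lincomb[OF assms(1,2) H10_H1[OF assms(3)] test_function_H1[OF assms(1,2) \<psi>(1)], of "-1"]
      H1_lincomb[OF assms(1,2) H10_H1[OF assms(4)] test_function_H1[OF assms(1,2) \<xi>(1)], of "-1"]
    by simp_all
  have "(\<lambda>n. H1_norm \<Omega> (\<lambda>x. (v x + c * w x) - (\<psi> n x + c * \<xi> n x))) \<longlonglongrightarrow> 0"
  proof (rule tendsto_sandwich[OF _ _ tendsto_const])
    let ?b = "\<lambda>n. sqrt (2 * (H1_norm \<Omega> (\<lambda>x. v x - \<psi> n x))\<^sup>2 + 2 * c\<^sup>2 * (H1_norm \<Omega> (\<lambda>x. w x - \<xi> n x))\<^sup>2)"
    have "H1_norm \<Omega> (\<lambda>x. (v x + c * w x) - (\<psi> n x + c * \<xi> n x)) \<le> ?b n" for n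
      using H1_norm_lincomb_le[OF assms(1,2) diff[of n], of c] by (simp add: algebra_simps)
    then show "\<forall>\<^sub>F n in sequentially. H1_norm \<Omega> (\<lambda>x. (v x + c * w x) - (\<psi> n x + c * \<xi> n x)) \<le> ?b n"
      by simp
    have "?b \<longlonglongrightarrow> sqrt (2 * 0\<^sup>2 + 2 * c\<^sup>2 * 0\<^sup>2)"
      by (intro tendsto_real_sqrt tendsto_add tendsto_mult tendsto_const tendsto_power \<psi>(2) \<xi>(2))
    then show "?b \<longlonglongrightarrow> 0" by simp
  qed (simp_all add: H1_norm_nonneg)
  moreover have "test_function \<Omega> (\<lambda>x. \<psi> n x + c * \<xi> n x)" for n
    by (rule test_function_lincomb[OF \<psi>(1) \<xi>(1)])
  ultimately have "\<exists>\<psi>. (\<forall>n. test_function \<Omega> (\<psi> n)) \<and>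
      (\<lambda>n. H1_norm \<Omega> (\<lambda>x. (v x + c * w x) - \<psi> n x)) \<longlonglongrightarrow> 0"
    by (intro exI[of _ "\<lambda>n x. \<psi> n x + c * \<xi> n x"]) simp
  then show ?thesis
    using H1_lincomb[OF assms(1,2) H10_H1[OF assms(3)] H10_H1[OF assms(4)], of c]
    by (simp add: H10_def)
qed

section \<open>The bilinear form\<close>

text \<open>The tensor is bounded entry by entry, so the integrand is expanded into entries times
  products of two square integrable components.\<close>

lemma integrable_diffusion_term:
  assumes "\<And>i j. Linf \<Omega> (\<lambda>x. D x $ i $ j)" "L2 \<Omega> g" "L2 \<Omega> h"
  shows "integrable (lebesgue_on \<Omega>) (\<lambda>x. (D x *v g x) \<bullet> h x)"
proof -
  have "(D x *v g x) \<bullet> h x = (\<Sum>i\<in>UNIV. \<Sum>j\<in>UNIV. D x $ i $ j * (g x $ j * h x $ i))" for x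
    by (simp add: inner_vec_def matrix_vector_mult_def sum_distrib_right mult.assoc)
  moreover have "integrable (lebesgue_on \<Omega>) (\<lambda>x. \<Sum>i\<in>UNIV. \<Sum>j\<in>UNIV. D x $ i $ j * (g x $ j * h x $ i))"
    by (intro Bochner_Integration.integrable_sum integrable_Linf_mult[OF assms(1)]
        integrable_mult_L2[OF L2_nth[OF assms(2)] L2_nth[OF assms(3)]])
  ultimately show ?thesis by simp
qed

lemma integrable_reaction_term:
  assumes "Linf \<Omega> \<mu>" "L2 \<Omega> v" "L2 \<Omega> w"
  shows "integrable (lebesgue_on \<Omega>) (\<lambda>x. \<mu> x * v x * w x)"
  using integrable_Linf_mult[OF assms(1) integrable_mult_L2[OF assms(2,3)]] by (simp add: mult.assoc)

lemma a_form_lincomb_left: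
  assumes "open \<Omega>" "bounded \<Omega>" "\<And>i j. Linf \<Omega> (\<lambda>x. D x $ i $ j)" "Linf \<Omega> \<mu>"
    and "v \<in> H1 \<Omega>" "w \<in> H1 \<Omega>" "z \<in> H1 \<Omega>"
  shows "a_form \<Omega> D \<mu> (\<lambda>x. v x + c * w x) z = a_form \<Omega> D \<mu> v z + c * a_form \<Omega> D \<mu> w z"
proof -
  let ?L = "lebesgue_on \<Omega>"
  note d = integrable_diffusion_term[where D=D, OF assms(3)]
  note r = integrable_reaction_term[OF assms(4)]
  note int = d[OF L2_grad[OF assms(5)] L2_grad[OF assms(7)]] d[OF L2_grad[OF assms(6)] L2_grad[OF assms(7)]]
    r[OF L2_H1[OF assms(5)] L2_H1[OF assms(7)]] r[OF L2_H1[OF assms(6)] L2_H1[OF assms(7)]]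
  have "(LINT x|?L. (D x *v grad \<Omega> (\<lambda>x. v x + c * w x) x) \<bullet> grad \<Omega> z x) =
      (LINT x|?L. (D x *v grad \<Omega> v x) \<bullet> grad \<Omega> z x + c * ((D x *v grad \<Omega> w x) \<bullet> grad \<Omega> z x))"
  proof (rule integral_cong_AE)
    show "AE x in ?L. (D x *v grad \<Omega> (\<lambda>x. v x + c * w x) x) \<bullet> grad \<Omega> z x =
        (D x *v grad \<Omega> v x) \<bullet> grad \<Omega> z x + c * ((D x *v grad \<Omega> w x) \<bullet> grad \<Omega> z x)"
      using grad_lincomb[OF assms(1,2,5,6), of c]
      by eventually_elim (simp add: matrix_vector_right_distrib matrix_vector_mult_scaleR inner_simps)
    show "(\<lambda>x. (D x *v grad \<Omega> (\<lambda>x. v x + c * w x) x) \<bullet> grad \<Omega> z x) \<in> borel_measurable ?L"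
      by (rule borel_measurable_integrable[OF d[OF L2_grad[OF H1_lincomb[OF assms(1,2,5,6)]]
              L2_grad[OF assms(7)]]])
    show "(\<lambda>x. (D x *v grad \<Omega> v x) \<bullet> grad \<Omega> z x + c * ((D x *v grad \<Omega> w x) \<bullet> grad \<Omega> z x)) \<in> borel_measurable ?L"
      using int by simp
  qed
  also have "\<dots> = (LINT x|?L. (D x *v grad \<Omega> v x) \<bullet> grad \<Omega> z x) + c * (LINT x|?L. (D x *v grad \<Omega> w x) \<bullet> grad \<Omega> z x)"
    using int by simp
  moreover have "(LINT x|?L. \<mu> x * (v x + c * w x) * z x) = (LINT x|?L. \<mu> x * v x * z x) + c * (LINT x|?L. \<mu> x * w x * z x)"
  proof -
    have "\<mu> x * (v x + c * w x) * z x = \<mu> x * v x * z x + c * (\<mu> x * w x * z x)" for x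
      by (simp add: algebra_simps)
    then show ?thesis using int by simp
  qed
  ultimately show ?thesis
    by (simp add: a_form_def distrib_left)
qed

lemma inner_matrix_vector_symmetric:
  fixes A :: "real^'n^'n"
  assumes "transpose A = A"
  shows "(A *v x) \<bullet> y = (A *v y) \<bullet> x"
  using dot_lmul_matrix[of x A y] transpose_matrix_vector[of A x] assms by (simp add: inner_commute)

lemma a_form_commute:
  assumes "\<And>i j. Linf \<Omega> (\<lambda>x. D x $ i $ j)" "AE x in lebesgue_on \<Omega>. transpose (D x) = D x"
    and "v \<in> H1 \<Omega>" "w \<in> H1 \<Omega>"
  shows "a_form \<Omega> D \<mu> v w = a_form \<Omega> D \<mu> w v"
proof -
  note d = borel_measurable_integrable[OF integrable_diffusion_term[where D=D, OF assms(1)]]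
  have "(LINT x|lebesgue_on \<Omega>. (D x *v grad \<Omega> v x) \<bullet> grad \<Omega> w x) =
      (LINT x|lebesgue_on \<Omega>. (D x *v grad \<Omega> w x) \<bullet> grad \<Omega> v x)"
  proof (rule integral_cong_AE)
    show "AE x in lebesgue_on \<Omega>. (D x *v grad \<Omega> v x) \<bullet> grad \<Omega> w x = (D x *v grad \<Omega> w x) \<bullet> grad \<Omega> v x"
      using assms(2) by eventually_elim (rule inner_matrix_vector_symmetric)
  qed (intro d L2_grad assms)+
  moreover have "(LINT x|lebesgue_on \<Omega>. \<mu> x * v x * w x) = (LINT x|lebesgue_on \<Omega>. \<mu> x * w x * v x)"
    by (simp add: ac_simps)
  ultimately show ?thesis by (simp add: a_form_def)
qed

lemma a_form_nonneg:
  assumes "AE x in lebesgue_on \<Omega>. \<forall>y. y \<bullet> (D x *v y) \<ge> 0" "AE x in lebesgue_on \<Omega>. \<mu> x \<ge> 0"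
  shows "a_form \<Omega> D \<mu> v v \<ge> 0"
  unfolding a_form_def
proof (intro add_nonneg_nonneg integral_nonneg_AE)
  show "AE x in lebesgue_on \<Omega>. (D x *v grad \<Omega> v x) \<bullet> grad \<Omega> v x \<ge> 0"
    using assms(1) by eventually_elim (simp add: inner_commute)
  show "AE x in lebesgue_on \<Omega>. \<mu> x * v x * v x \<ge> 0"
    using assms(2) by eventually_elim (simp add: mult.assoc)
qed

text \<open>From here on the form is handled abstractly, as a symmetric positive semidefinite
  bilinear form on \<open>H1 \<Omega>\<close>.\<close>

lemma
  assumes "open \<Omega>" "bounded \<Omega>" "diffusion_tensor \<Omega> d\<^sub>0 D" "reaction_coefficient \<Omega> \<mu>\<^sub>0 \<mu>"
    and "v \<in> H1 \<Omega>" "w \<in> H1 \<Omega>"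
  shows a_form_lincomb: "z \<in> H1 \<Omega> \<Longrightarrow> a_form \<Omega> D \<mu> (\<lambda>x. v x + c * w x) z = a_form \<Omega> D \<mu> v z + c * a_form \<Omega> D \<mu> w z"
    and a_form_sym: "a_form \<Omega> D \<mu> v w = a_form \<Omega> D \<mu> w v"
    and a_form_pos: "a_form \<Omega> D \<mu> v v \<ge> 0"
proof -
  note D = assms(3)[unfolded diffusion_tensor_def] and \<mu> = assms(4)[unfolded reaction_coefficient_def]
  have Linf: "Linf \<Omega> (\<lambda>x. D x $ i $ j)" for i j using D by blast
  show "z \<in> H1 \<Omega> \<Longrightarrow> a_form \<Omega> D \<mu> (\<lambda>x. v x + c * w x) z = a_form \<Omega> D \<mu> v z + c * a_form \<Omega> D \<mu> w z"
    using \<mu> by (intro a_form_lincomb_left assms Linf) simp_all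
  show "a_form \<Omega> D \<mu> v w = a_form \<Omega> D \<mu> w v"
    using D by (intro a_form_commute assms Linf) simp_all
  have d: "AE x in lebesgue_on \<Omega>. \<forall>y. y \<bullet> (D x *v y) \<ge> d\<^sub>0 * (norm y)\<^sup>2" "d\<^sub>0 > 0"
    using D by auto
  from d(1) have "AE x in lebesgue_on \<Omega>. \<forall>y. y \<bullet> (D x *v y) \<ge> 0"
  proof eventually_elim
    case (elim x)
    have "0 \<le> d\<^sub>0 * (norm y)\<^sup>2" for y :: "real^'a" using d(2) by simp
    with elim show ?case using order_trans by blast
  qed
  moreover have "AE x in lebesgue_on \<Omega>. \<mu> x \<ge> \<mu>\<^sub>0" "\<mu>\<^sub>0 \<ge> 0" using \<mu> by auto
  then have "AE x in lebesgue_on \<Omega>. \<mu> x \<ge> 0" by (auto elim: eventually_mono)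
  ultimately show "a_form \<Omega> D \<mu> v v \<ge> 0" by (rule a_form_nonneg)
qed

section \<open>Squares and the Cauchy-Schwarz inequality for the form\<close>

text \<open>One expansion for two purposes: Cauchy-Schwarz lets c vary, best approximation takes c =
  1.\<close>

lemma a_form_lincomb_square:
  assumes "open \<Omega>" "bounded \<Omega>" "diffusion_tensor \<Omega> d\<^sub>0 D" "reaction_coefficient \<Omega> \<mu>\<^sub>0 \<mu>"
    and "v \<in> H1 \<Omega>" "w \<in> H1 \<Omega>"
  shows "a_form \<Omega> D \<mu> (\<lambda>x. v x + c * w x) (\<lambda>x. v x + c * w x) =
    a_form \<Omega> D \<mu> v v + 2 * c * a_form \<Omega> D \<mu> v w + c\<^sup>2 * a_form \<Omega> D \<mu> w w"
proof -
  note lin = a_form_lincomb[OF assms(1-4)] and sym = a_form_sym[OF assms(1-4)]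
  let ?z = "\<lambda>x. v x + c * w x"
  have z: "?z \<in> H1 \<Omega>" by (rule H1_lincomb[OF assms(1,2,5,6)])
  have "a_form \<Omega> D \<mu> ?z ?z = a_form \<Omega> D \<mu> ?z v + c * a_form \<Omega> D \<mu> ?z w"
    by (simp only: lin[OF assms(5,6) z] sym[OF z assms(5)] sym[OF z assms(6)])
  also have "\<dots> = (a_form \<Omega> D \<mu> v v + c * a_form \<Omega> D \<mu> w v) + c * (a_form \<Omega> D \<mu> v w + c * a_form \<Omega> D \<mu> w w)"
    by (simp only: lin[OF assms(5,6,5)] lin[OF assms(5,6,6)])
  finally show ?thesis
    by (simp add: sym[OF assms(6,5)] algebra_simps power2_eq_square)
qed

lemma quadratic_nonneg_discriminant:
  fixes A B C :: real
  assumes "\<And>c. 0 \<le> A + 2 * c * B + c\<^sup>2 * C" "0 \<le> C"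
  shows "B\<^sup>2 \<le> A * C"
proof (cases "C = 0")
  case True
  have "B = 0"
  proof (rule ccontr)
    assume "B \<noteq> 0"
    \<comment> \<open>With C = 0 the expression is affine in c, and this c gives it the value
      -1.\<close>
    then have "2 * (- (A + 1) / (2 * B)) * B = - (A + 1)" by simp
    with assms(1)[of "- (A + 1) / (2 * B)"] True show False by simp
  qed
  with True show ?thesis by simp
next
  case False
  with assms(2) have "C > 0" by simp
  \<comment> \<open>The minimiser of the quadratic is c = - B / C.\<close>
  then have "A + 2 * (- B / C) * B + (- B / C)\<^sup>2 * C = (A * C - B\<^sup>2) / C"
    by (simp add: field_simps power2_eq_square)
  with assms(1)[of "- B / C"] \<open>C > 0\<close> show ?thesis by (simp add: zero_le_divide_iff)
qed

lemma a_norm_nonneg: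
  assumes "open \<Omega>" "bounded \<Omega>" "diffusion_tensor \<Omega> d\<^sub>0 D" "reaction_coefficient \<Omega> \<mu>\<^sub>0 \<mu>" "v \<in> H1 \<Omega>"
  shows "a_norm \<Omega> D \<mu> v \<ge> 0"
  using a_form_pos[OF assms assms(5)] by (simp add: a_norm_def)

lemma a_form_Cauchy_Schwarz:
  assumes "open \<Omega>" "bounded \<Omega>" "diffusion_tensor \<Omega> d\<^sub>0 D" "reaction_coefficient \<Omega> \<mu>\<^sub>0 \<mu>"
    and "v \<in> H1 \<Omega>" "w \<in> H1 \<Omega>"
  shows "a_form \<Omega> D \<mu> v w \<le> a_norm \<Omega> D \<mu> v * a_norm \<Omega> D \<mu> w"
proof -
  have "(a_form \<Omega> D \<mu> v w)\<^sup>2 \<le> a_form \<Omega> D \<mu> v v * a_form \<Omega> D \<mu> w w"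
  proof (rule quadratic_nonneg_discriminant)
    fix c
    have z: "(\<lambda>x. v x + c * w x) \<in> H1 \<Omega>" by (rule H1_lincomb[OF assms(1,2,5,6)])
    show "0 \<le> a_form \<Omega> D \<mu> v v + 2 * c * a_form \<Omega> D \<mu> v w + c\<^sup>2 * a_form \<Omega> D \<mu> w w"
      using a_form_pos[OF assms(1-4) z z] by (simp only: a_form_lincomb_square[OF assms])
  qed (rule a_form_pos[OF assms(1-4,6,6)])
  then show ?thesis
    unfolding a_norm_def real_sqrt_mult[symmetric] by (rule real_le_rsqrt)
qed

section \<open>The mesh\<close>

lemma polynomials_lincomb:
  assumes "p \<in> polynomials E" "q \<in> polynomials E"
  shows "(\<lambda>x. p x + c * q x) \<in> polynomials E"
proof -
  obtain a b where "p = (\<lambda>x. \<Sum>\<beta>\<in>E. a \<beta> * (\<Prod>i\<in>UNIV. x $ i ^ \<beta> i))"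
    "q = (\<lambda>x. \<Sum>\<beta>\<in>E. b \<beta> * (\<Prod>i\<in>UNIV. x $ i ^ \<beta> i))"
    using assms by (auto simp: polynomials_def)
  then have "(\<lambda>x. p x + c * q x) = (\<lambda>x. \<Sum>\<beta>\<in>E. (a \<beta> + c * b \<beta>) * (\<Prod>i\<in>UNIV. x $ i ^ \<beta> i))"
    by (simp add: sum_distrib_left sum.distrib distrib_right mult.assoc)
  then show ?thesis
    unfolding polynomials_def by (intro CollectI exI[where x="\<lambda>\<beta>. a \<beta> + c * b \<beta>"])
qed

lemma cell_polynomials_lincomb:
  assumes "p \<in> cell_polynomials s k K" "q \<in> cell_polynomials s k K"
  shows "(\<lambda>x. p x + c * q x) \<in> cell_polynomials s k K"
proof (cases s)
  case Simplex
  with assms show ?thesis by (simp add: polynomials_lincomb)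
next
  case Cube
  show ?thesis
    unfolding Cube cell_polynomials.simps
  proof (rule CollectI, intro allI impI)
    fix T assume "cell_map Cube K T"
    with assms have "p \<circ> T \<in> polynomials {\<beta>. \<forall>i. \<beta> i \<le> k}" "q \<circ> T \<in> polynomials {\<beta>. \<forall>i. \<beta> i \<le> k}"
      by (simp_all add: Cube)
    from polynomials_lincomb[OF this, of c]
    show "(\<lambda>x. p x + c * q x) \<circ> T \<in> polynomials {\<beta>. \<forall>i. \<beta> i \<le> k}" by (simp add: o_def)
  qed
qed

lemma compact_convex_cell:
  assumes "cell_map s K T"
  shows "compact K" "convex K"
proof -
  obtain A b where T: "T = (\<lambda>x. A *v x + b)" and K: "K = T ` reference_cell s"
    using assms by (auto simp: cell_map_def)
  have R: "compact (reference_cell s)" "convex (reference_cell s)"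
    by (cases s; simp add: finite_imp_compact_convex_hull)+
  have "continuous_on (reference_cell s) T"
    unfolding T by (intro continuous_on_add matrix_vector_mult_linear_continuous_on continuous_on_const)
  then show "compact K"
    unfolding K using R(1) by (rule compact_continuous_image)
  have "K = (\<lambda>x. b + x) ` (*v) A ` reference_cell s"
    by (simp add: K T image_image add.commute)
  then show "convex K"
    using convex_translation[OF convex_linear_image[OF matrix_vector_mul_linear R(2)]] by simp
qed

section \<open>Sign of a polynomial on a cell from its signs at the vertices\<close>

text \<open>An exponent of total degree at most one leaves a single coordinate or the constant 1,
  and the latter is reproduced because the weights sum to 1.\<close>

lemma affine_monomial:
  fixes x y :: "real^'n" and u v :: real
  assumes "(\<Sum>i\<in>UNIV. \<beta> i) \<le> (1::nat)" "u + v = 1"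
  shows "(\<Prod>i\<in>UNIV. (u *\<^sub>R x + v *\<^sub>R y) $ i ^ \<beta> i) =
    u * (\<Prod>i\<in>UNIV. x $ i ^ \<beta> i) + v * (\<Prod>i\<in>UNIV. y $ i ^ \<beta> i)"
proof (cases "\<forall>i. \<beta> i = 0")
  case True
  with assms(2) show ?thesis by simp
next
  case False
  then obtain j where j: "\<beta> j \<noteq> 0" by blast
  have "(\<Sum>i\<in>UNIV. \<beta> i) = \<beta> j + (\<Sum>i\<in>UNIV - {j}. \<beta> i)" by (simp add: sum.remove)
  with assms(1) j have "\<beta> j = 1" "(\<Sum>i\<in>UNIV - {j}. \<beta> i) = 0" by linarith+
  then have "(\<Prod>i\<in>UNIV. z $ i ^ \<beta> i) = z $ j" for z :: "real^'n"
    by (simp add: prod.remove[of UNIV j])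
  from this[of x] this[of y] this[of "u *\<^sub>R x + v *\<^sub>R y"] show ?thesis by simp
qed

text \<open>As p is affine, the points where it is nonnegative form a convex set; it contains the
  extreme points, whose hull is K by the Krein-Milman theorem.\<close>

lemma nonneg_on_simplex:
  assumes "p \<in> polynomials {\<beta>. (\<Sum>i\<in>UNIV. \<beta> i) \<le> 1}" "compact K" "convex K"
    and "\<And>y. y extreme_point_of K \<Longrightarrow> p y \<ge> 0" "x \<in> K"
  shows "p x \<ge> 0"
proof -
  have aff: "p (u *\<^sub>R y + v *\<^sub>R z) = u * p y + v * p z" if "u + v = 1" for u v y z
  proof -
    obtain c where "p = (\<lambda>x. \<Sum>\<beta>\<in>{\<beta>. (\<Sum>i\<in>UNIV. \<beta> i) \<le> 1}. c \<beta> * (\<Prod>i\<in>UNIV. x $ i ^ \<beta> i))"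
      using assms(1) by (auto simp: polynomials_def)
    then show ?thesis
      using affine_monomial[OF _ that, of _ y z]
      by (simp add: sum_distrib_left sum.distrib[symmetric] distrib_left mult.left_commute del: vector_add_component vector_scaleR_component)
  qed
  have "convex {y. p y \<ge> 0}"
    unfolding convex_def by (auto simp: aff)
  then have "convex hull {y. y extreme_point_of K} \<subseteq> {y. p y \<ge> 0}"
    using assms(4) by (intro hull_minimal) auto
  then show ?thesis
    using assms(5) Krein_Milman_Minkowski[OF assms(2,3)] by auto
qed

text \<open>With degree at most one in the j-th variable, q interpolates linearly between its values
  on the faces where this variable is 0 and 1.\<close>

lemma multiaffine_split:
  fixes x :: "real^'n"
  assumes "q \<in> polynomials {\<beta>. \<forall>i. \<beta> i \<le> 1}"
  shows "q x = (1 - x $ j) * q (\<chi> i. if i = j then 0 else x $ i) + x $ j * q (\<chi> i. if i = j then 1 else x $ i)"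
proof -
  obtain c where q: "q = (\<lambda>x. \<Sum>\<beta>\<in>{\<beta>. \<forall>i. \<beta> i \<le> 1}. c \<beta> * (\<Prod>i\<in>UNIV. x $ i ^ \<beta> i))"
    using assms by (auto simp: polynomials_def)
  have m: "(\<Prod>i\<in>UNIV. x $ i ^ \<beta> i) = (1 - x $ j) * (\<Prod>i\<in>UNIV. (\<chi> i. if i = j then 0 else x $ i) $ i ^ \<beta> i) +
      x $ j * (\<Prod>i\<in>UNIV. (\<chi> i. if i = j then 1 else x $ i) $ i ^ \<beta> i)"
    if "\<forall>i. \<beta> i \<le> (1::nat)" for \<beta>
  proof -
    let ?R = "\<Prod>i\<in>UNIV - {j}. x $ i ^ \<beta> i"
    have split: "(\<Prod>i\<in>UNIV. (\<chi> i. if i = j then t else x $ i) $ i ^ \<beta> i) = t ^ \<beta> j * ?R" for t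
      by (simp add: prod.remove[of UNIV j])
    have "(\<Prod>i\<in>UNIV. x $ i ^ \<beta> i) = x $ j ^ \<beta> j * ?R" by (simp add: prod.remove)
    \<comment> \<open>For exponents 0 and 1 a power interpolates its own values at 0 and 1; here 0 ^
      0 = 1 counts.\<close>
    moreover have "x $ j ^ \<beta> j = (1 - x $ j) * 0 ^ \<beta> j + x $ j * 1 ^ \<beta> j"
      using that[rule_format, of j] by (cases "\<beta> j") simp_all
    ultimately show ?thesis
      unfolding split by (simp only: distrib_right mult.assoc)
  qed
  show ?thesis
    unfolding q sum_distrib_left sum.distrib[symmetric]
  proof (rule sum.cong[OF refl])
    fix \<beta> :: "'n \<Rightarrow> nat" assume "\<beta> \<in> {\<beta>. \<forall>i. \<beta> i \<le> 1}"
    then show "c \<beta> * (\<Prod>i\<in>UNIV. x $ i ^ \<beta> i) =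
      (1 - x $ j) * (c \<beta> * (\<Prod>i\<in>UNIV. (\<chi> i. if i = j then 0 else x $ i) $ i ^ \<beta> i)) +
      x $ j * (c \<beta> * (\<Prod>i\<in>UNIV. (\<chi> i. if i = j then 1 else x $ i) $ i ^ \<beta> i))"
      by (subst m) (simp_all add: distrib_left mult.left_commute)
  qed
qed

text \<open>The nonnegativity set of a multiaffine function need not be convex, so the extreme point
  argument for affine functions fails. Instead the coordinates are moved to 0 or 1 one at a
  time.\<close>

lemma nonneg_on_cube:
  fixes x :: "real^'n"
  assumes q: "q \<in> polynomials {\<beta>. \<forall>i. \<beta> i \<le> 1}"
    and vertex: "\<And>c. (\<And>i. c $ i \<in> {0, 1}) \<Longrightarrow> q c \<ge> 0" and "x \<in> cbox 0 1"
  shows "q x \<ge> 0"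
proof -
  \<comment> \<open>I collects the coordinates that may still lie strictly between 0 and 1; the
    claim is the case I = UNIV.\<close>
  have "q x \<ge> 0" if "finite I" "x \<in> cbox 0 1" "\<And>i. i \<notin> I \<Longrightarrow> x $ i \<in> {0, 1}" for I x
    using that
  proof (induction I arbitrary: x rule: finite_induct)
    case empty
    then show ?case by (intro vertex) simp
  next
    case (insert j I)
    have x: "0 \<le> x $ i" "x $ i \<le> 1" for i
      using insert.prems(1) by (auto simp: mem_box_cart)
    have "q (\<chi> i. if i = j then t else x $ i) \<ge> 0" if "t \<in> {0, 1}" for t
    proof (rule insert.IH)
      show "(\<chi> i. if i = j then t else x $ i) \<in> cbox 0 1"
        using x that by (auto simp: mem_box_cart)
      show "(\<chi> i. if i = j then t else x $ i) $ i \<in> {0, 1}" if "i \<notin> I" for i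
        using insert.prems(2)[of i] that \<open>t \<in> {0, 1}\<close> by auto
    qed
    then show ?case
      unfolding multiaffine_split[OF q, of x j] using x[of j] by (intro add_nonneg_nonneg mult_nonneg_nonneg) simp_all
  qed
  from this[of UNIV x] assms(3) show ?thesis by simp
qed

text \<open>Links the vertices of the reference cube with the extreme points, where the mesh
  function is prescribed. A coordinate equal to 0 or 1 is a proper convex combination of numbers in
  [0, 1] only if both equal it.\<close>

lemma extreme_point_cube_vertex:
  fixes c :: "real^'n"
  assumes "cell_map Cube K T" and c: "\<And>i. c $ i \<in> {0, 1}"
  shows "T c extreme_point_of K"
proof -
  obtain A b where A: "invertible A" and T: "T = (\<lambda>x. A *v x + b)"
    using assms(1) by (auto simp: cell_map_def)
  have K: "K = T ` cbox 0 1" using assms(1) by (simp add: cell_map_def)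
  have "c \<in> cbox 0 1"
    unfolding mem_box_cart using c by (metis empty_iff insertE one_index order_refl zero_index zero_le_one)
  moreover have "T c \<notin> open_segment (T y) (T z)" if y: "y \<in> cbox 0 1" and z: "z \<in> cbox 0 1" for y z
  proof
    assume "T c \<in> open_segment (T y) (T z)"
    then obtain u where u: "T y \<noteq> T z" "0 < u" "u < 1" "T c = (1 - u) *\<^sub>R T y + u *\<^sub>R T z"
      by (auto simp: in_segment)
    have "(1 - u) *\<^sub>R T y + u *\<^sub>R T z = T ((1 - u) *\<^sub>R y + u *\<^sub>R z)"
      by (simp add: T matrix_vector_right_distrib matrix_vector_mult_scaleR algebra_simps)
    with u(4) have "A *v c = A *v ((1 - u) *\<^sub>R y + u *\<^sub>R z)" by (simp add: T)
    \<comment> \<open>Invertibility of A pulls the segment back to the reference cube.\<close>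
    then have eq: "c = (1 - u) *\<^sub>R y + u *\<^sub>R z"
      using inj_matrix_vector_mult[OF A] by (simp add: inj_eq)
    from u(1) obtain j where j: "y $ j \<noteq> z $ j" by (metis vec_eq_iff)
    have cj: "c $ j = (1 - u) * y $ j + u * z $ j" by (simp add: eq)
    have b: "0 \<le> y $ j" "y $ j \<le> 1" "0 \<le> z $ j" "z $ j \<le> 1"
      using y z by (simp_all add: mem_box_cart)
    have "c $ j = 0 \<or> c $ j = 1" using c by auto
    then show False
    proof
      assume "c $ j = 0"
      then have "(1 - u) * y $ j = 0" "u * z $ j = 0"
        using cj b u(2,3) by (simp_all add: add_nonneg_eq_0_iff)
      with u(2,3) j show False by simp
    next
      assume "c $ j = 1"
      \<comment> \<open>The reflection t -> 1 - t reduces this case to the pattern of the other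
        one.\<close>
      then have "(1 - u) * (1 - y $ j) + u * (1 - z $ j) = 0"
        using cj by (simp add: algebra_simps)
      then have "(1 - u) * (1 - y $ j) = 0" "u * (1 - z $ j) = 0"
        using b u(2,3) by (simp_all add: add_nonneg_eq_0_iff)
      with u(2,3) j show False by simp
    qed
  qed
  ultimately show ?thesis
    unfolding extreme_point_of_def K by blast
qed

lemma mesh_function_nonneg:
  assumes "conforming_partition s \<Omega> P" "mesh_function s P \<hh>" "K \<in> P" "x \<in> K"
  shows "\<hh> x \<ge> 0"
proof -
  have cells: "\<exists>T. cell_map s L T" if "L \<in> P" for L
    using assms(1) that by (auto simp: conforming_partition_def)
  obtain T where T: "cell_map s K T" using cells[OF assms(3)] by blast
  obtain p where p: "p \<in> cell_polynomials s 1 K" and hp: "\<And>y. y \<in> K \<Longrightarrow> \<hh> y = p y"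
    using assms(2,3) by (auto simp: mesh_function_def)
  have ext: "p y \<ge> 0" if "y extreme_point_of K" for y
  proof -
    have "\<hh> y = (\<Sum>L\<in>cells_at P y. diameter L) / real (card (cells_at P y))"
      using assms(2,3) that by (auto simp: mesh_function_def)
    moreover have "(\<Sum>L\<in>cells_at P y. diameter L) \<ge> 0"
    proof (intro sum_nonneg diameter_ge_0 compact_imp_bounded)
      \<comment> \<open>Nonnegativity of a diameter is available for bounded sets, hence the detour
        through compactness of cells.\<close>
      fix L assume "L \<in> cells_at P y"
      with cells obtain T where "cell_map s L T" by (auto simp: cells_at_def)
      then show "compact L" by (rule compact_convex_cell)
    qed
    moreover have "y \<in> K" using that by (simp add: extreme_point_of_def)
    ultimately show ?thesis using hp by simp
  qed
  have "p x \<ge> 0"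
  proof (cases s)
    case Simplex
    with p have "p \<in> polynomials {\<beta>. (\<Sum>i\<in>UNIV. \<beta> i) \<le> 1}" by simp
    from nonneg_on_simplex[OF this compact_convex_cell[OF T] ext assms(4)] show ?thesis .
  next
    case Cube
    with T p have "p \<circ> T \<in> polynomials {\<beta>. \<forall>i. \<beta> i \<le> 1}" by simp
    moreover have "(p \<circ> T) c \<ge> 0" if "\<And>i. c $ i \<in> {0, 1}" for c
      using ext extreme_point_cube_vertex[of K T c] that T Cube by simp
    moreover obtain z where "z \<in> cbox 0 1" "x = T z"
      using T assms(4) by (auto simp: Cube cell_map_def)
    ultimately show ?thesis using nonneg_on_cube[of "p \<circ> T" z] by simp
  qed
  with hp assms(4) show ?thesis by simp
qed

section \<open>The finite element space\<close>

lemma fe_space_lincomb: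
  assumes "open \<Omega>" "bounded \<Omega>" "v \<in> fe_space s k \<Omega> P" "w \<in> fe_space s k \<Omega> P"
  shows "(\<lambda>x. v x + c * w x) \<in> fe_space s k \<Omega> P"
proof -
  have "\<exists>p\<in>cell_polynomials s k K. \<forall>x\<in>K \<inter> \<Omega>. v x + c * w x = p x" if "K \<in> P" for K
  proof -
    obtain p q where "p \<in> cell_polynomials s k K" "\<forall>x\<in>K \<inter> \<Omega>. v x = p x"
      "q \<in> cell_polynomials s k K" "\<forall>x\<in>K \<inter> \<Omega>. w x = q x"
      using assms(3,4) \<open>K \<in> P\<close> unfolding fe_space_def by blast
    then show ?thesis
      by (intro bexI[where x="\<lambda>x. p x + c * q x"] cell_polynomials_lincomb) simp_all
  qed
  moreover have "continuous_on \<Omega> (\<lambda>x. v x + c * w x)"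
    using assms(3,4) by (intro continuous_on_add continuous_on_mult continuous_on_const) (simp_all add: fe_space_def)
  moreover have "(\<lambda>x. v x + c * w x) \<in> H10 \<Omega>"
    using assms by (intro H10_lincomb) (simp_all add: fe_space_def)
  ultimately show ?thesis by (simp add: fe_space_def)
qed

lemma fe_space_sum:
  assumes "open \<Omega>" "bounded \<Omega>" "fe_space s k \<Omega> P \<noteq> {}" "finite I"
    and "\<And>i. i \<in> I \<Longrightarrow> v i \<in> fe_space s k \<Omega> P"
  shows "(\<lambda>x. \<Sum>i\<in>I. c i * v i x) \<in> fe_space s k \<Omega> P"
  using assms(4,5)
proof (induction I rule: finite_induct)
  case empty
  \<comment> \<open>The zero function arises as w - w from any member of the space.\<close>
  obtain w where w: "w \<in> fe_space s k \<Omega> P" using assms(3) by blast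
  from fe_space_lincomb[OF assms(1,2) w w, of "-1"] show ?case by simp
next
  case (insert i I)
  have "(\<lambda>x. (\<Sum>i\<in>I. c i * v i x) + c i * v i x) \<in> fe_space s k \<Omega> P"
    using insert.IH insert.prems by (intro fe_space_lincomb[OF assms(1,2)]) simp_all
  then show ?case using insert.hyps by (simp add: add.commute)
qed

lemma fe_space_H1: "v \<in> fe_space s k \<Omega> P \<Longrightarrow> v \<in> H1 \<Omega>"
  by (simp add: fe_space_def H10_def)

text \<open>A sum over an infinite set of nodes would be zero, contradicting \<open>\<phi> x x = 1\<close>.\<close>

lemma finite_internal_nodes:
  assumes "lagrange_basis s k \<Omega> P \<phi>"
  shows "finite (internal_nodes s k \<Omega> P)"
proof (rule ccontr)
  let ?X = "internal_nodes s k \<Omega> P"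
  assume inf: "infinite ?X"
  then obtain x where x: "x \<in> ?X" by fastforce
  then have "x \<in> \<Omega>" by (simp add: internal_nodes_def)
  moreover have "\<phi> x \<in> fe_space s k \<Omega> P" "\<phi> x x = 1"
    using assms x by (simp_all add: lagrange_basis_def)
  ultimately have "1 = (\<Sum>y\<in>?X. \<phi> x y * \<phi> y x)"
    using assms unfolding lagrange_basis_def by metis
  with inf show False by simp
qed

text \<open>Truncation acts on coefficients, and it is at the nodes that these are values of the
  function; all sign arguments are therefore made there.\<close>

lemma constrained_part_node:
  assumes "lagrange_basis s k \<Omega> P \<phi>" "y \<in> internal_nodes s k \<Omega> P"
  shows "constrained_part (internal_nodes s k \<Omega> P) \<phi> \<aa> v y = max 0 (min (v y) \<aa>)"
proof -
  let ?X = "internal_nodes s k \<Omega> P"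
  have "constrained_part ?X \<phi> \<aa> v y = (\<Sum>x\<in>?X. if x = y then max 0 (min (v x) \<aa>) else 0)"
    unfolding constrained_part_def
    using assms by (intro sum.cong refl) (simp add: lagrange_basis_def)
  then show ?thesis
    using assms(2) finite_internal_nodes[OF assms(1)] by simp
qed

lemma constrained_part_fe_space_plus:
  assumes "open \<Omega>" "bounded \<Omega>" "lagrange_basis s k \<Omega> P \<phi>" "\<aa> \<ge> 0" "fe_space s k \<Omega> P \<noteq> {}"
  shows "constrained_part (internal_nodes s k \<Omega> P) \<phi> \<aa> v \<in> fe_space_plus s k \<Omega> P \<aa>"
proof -
  have "constrained_part (internal_nodes s k \<Omega> P) \<phi> \<aa> v \<in> fe_space s k \<Omega> P"
    unfolding constrained_part_def
  proof (rule fe_space_sum[OF assms(1,2,5) finite_internal_nodes[OF assms(3)]])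
    show "\<phi> x \<in> fe_space s k \<Omega> P" if "x \<in> internal_nodes s k \<Omega> P" for x
      using assms(3) that by (simp add: lagrange_basis_def)
  qed
  then show ?thesis
    using assms(3,4) by (simp add: fe_space_plus_def constrained_part_node)
qed

section \<open>Signs in the stabilisation\<close>

text \<open>No measurability is assumed: a nonmeasurable function has essential supremum top, a null
  set gives minus infinity, and conversion to a real sends both to 0.\<close>

lemma linf_norm_nonneg: "linf_norm S g \<ge> 0"
proof -
  let ?f = "\<lambda>x. ereal \<bar>g x\<bar>" and ?M = "lebesgue_on S"
  consider "?f \<notin> borel_measurable ?M" | "esssup ?M ?f \<ge> 0" | "?f \<in> borel_measurable ?M" "esssup ?M ?f < 0"
    by fastforce
  then show ?thesis
  proof cases
    case 1
    then show ?thesis by (simp add: linf_norm_def esssup_non_measurable top_ereal_def)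
  next
    case 2
    then show ?thesis by (simp add: linf_norm_def real_of_ereal_pos)
  next
    case 3
    \<comment> \<open>Absolute values below a negative number almost everywhere mean that the whole
      space is null; then every z is an essential bound.\<close>
    have "AE x in ?M. False"
      using esssup_AE[of ?f ?M]
    proof eventually_elim
      case (elim x)
      from le_less_trans[OF elim 3(2)] have "ereal \<bar>g x\<bar> < 0" .
      then show ?case by simp
    qed
    then have "AE x in ?M. ?f x \<le> z" for z by eventually_elim simp
    then have "esssup ?M ?f = - \<infinity>" by (simp add: esssup_eq_AE[OF 3(1)] bot_ereal_def)
    then show ?thesis by (simp add: linf_norm_def)
  qed
qed

lemma s_form_nonneg:
  fixes P :: "(real^'n) set set"
  assumes "\<alpha> \<ge> 0" "\<And>x. x \<in> X \<Longrightarrow> \<hh> x \<ge> 0" "\<And>x. x \<in> X \<Longrightarrow> v x * w x \<ge> 0"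
  shows "s_form \<nu> P X \<hh> D \<mu> \<alpha> v w \<ge> 0"
  unfolding s_form_def
proof (intro mult_nonneg_nonneg[OF assms(1)] sum_nonneg)
  fix x assume x: "x \<in> X"
  let ?W = "linf_norm (patch P x) (\<lambda>y. \<nu> (D y)) * \<hh> x powi (int CARD('n) - 2) + linf_norm (patch P x) \<mu> * \<hh> x ^ CARD('n)"
  \<comment> \<open>Although d - 2 is negative for d = 1, an integer power of a nonnegative number
    is nonnegative, also at 0, where the inverse is 0 by convention.\<close>
  have "?W \<ge> 0"
    using assms(2)[OF x]
    by (intro add_nonneg_nonneg mult_nonneg_nonneg linf_norm_nonneg zero_le_power_int zero_le_power)
  with assms(3)[OF x] have "0 \<le> ?W * (v x * w x)" by (rule mult_nonneg_nonneg[rotated])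
  then show "0 \<le> ?W * v x * w x" by (simp only: mult.assoc)
qed

text \<open>The variational inequality of the projection onto [0, a] in one dimension: inside the
  interval the first factor is 0, outside it both factors point the same way.\<close>

lemma clip_sign:
  fixes t v a :: real
  assumes "0 \<le> v" "v \<le> a"
  shows "(t - max 0 (min t a)) * (max 0 (min t a) - v) \<ge> 0"
proof -
  consider "t < 0" | "0 \<le> t" "t \<le> a" | "a < t" by linarith
  then show ?thesis
    using assms by cases (auto simp: max_def min_def mult_nonpos_nonneg)
qed

theorem theorem3p7:
  fixes \<Omega> :: "(real^'n) set" and f :: "(real^'n \<Rightarrow> real) \<Rightarrow> real"
    and D :: "real^'n \<Rightarrow> real^'n^'n" and \<mu> :: "real^'n \<Rightarrow> real" and d\<^sub>0 \<mu>\<^sub>0 :: real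
    and s :: cell_shape and P :: "(real^'n) set set" and \<sigma> :: real and k :: nat
    and \<phi> :: "real^'n \<Rightarrow> real^'n \<Rightarrow> real" and \<hh> :: "real^'n \<Rightarrow> real"
    and \<nu> :: "real^'n^'n \<Rightarrow> real" and \<aa> \<alpha> C\<^sub>e\<^sub>q\<^sub>u\<^sub>i\<^sub>v :: real and u u\<^sub>h :: "real^'n \<Rightarrow> real"
  defines "V \<equiv> fe_space s k \<Omega> P"
    and "Vplus \<equiv> fe_space_plus s k \<Omega> P \<aa>"
    and "a \<equiv> a_form \<Omega> D \<mu>"
    and "anorm \<equiv> a_norm \<Omega> D \<mu>"
    and "stab \<equiv> s_form \<nu> P (internal_nodes s k \<Omega> P) \<hh> D \<mu> \<alpha>"
    and "snorm \<equiv> s_norm \<nu> P (internal_nodes s k \<Omega> P) \<hh> D \<mu> \<alpha>"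
    and "upos \<equiv> constrained_part (internal_nodes s k \<Omega> P) \<phi> \<aa> u\<^sub>h"
    and "uneg \<equiv> complementary_part (internal_nodes s k \<Omega> P) \<phi> \<aa> u\<^sub>h"
  assumes "CARD('n) \<in> {1, 2, 3}"
    and "polyhedral_lipschitz_domain \<Omega>"
    and "Hm1 \<Omega> f"
    and "diffusion_tensor \<Omega> d\<^sub>0 D"
    and "reaction_coefficient \<Omega> \<mu>\<^sub>0 \<mu>"
    and "conforming_partition s \<Omega> P"
    and "shape_regular \<sigma> P"
    and "k \<ge> 1"
    and "lagrange_basis s k \<Omega> P \<phi>"
    and "mesh_function s P \<hh>"
    and "matrix_norm \<nu>"
    and "\<aa> > 0"
    and "\<alpha> > 0"
    and "C\<^sub>e\<^sub>q\<^sub>u\<^sub>i\<^sub>v > 0"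
    and "\<forall>v\<in>V. (anorm v)\<^sup>2 \<le> C\<^sub>e\<^sub>q\<^sub>u\<^sub>i\<^sub>v / \<alpha> * (snorm v)\<^sup>2"
    and "u \<in> H10 \<Omega>" and "\<forall>v\<in>H10 \<Omega>. a u v = f v"
    and "u\<^sub>h \<in> V" and "\<forall>v\<in>V. a upos v + stab uneg v = f v"
  shows "is_arg_min (\<lambda>v. anorm (\<lambda>x. u x - v x)) (\<lambda>v. v \<in> Vplus) upos \<and>
    (\<forall>uFEM\<in>V. (\<forall>v\<in>V. a uFEM v = f v) \<longrightarrow>
       sqrt (stab uneg uneg) \<le> sqrt (C\<^sub>e\<^sub>q\<^sub>u\<^sub>i\<^sub>v / \<alpha>) *
         min (anorm (\<lambda>x. u x - upos x)) (anorm (\<lambda>x. uFEM x - upos x)))"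
proof -
  let ?X = "internal_nodes s k \<Omega> P"
  have dom: "open \<Omega>" "bounded \<Omega>"
    using \<open>polyhedral_lipschitz_domain \<Omega>\<close> by (simp_all add: polyhedral_lipschitz_domain_def)
  note basis = \<open>lagrange_basis s k \<Omega> P \<phi>\<close>
  note form = dom \<open>diffusion_tensor \<Omega> d\<^sub>0 D\<close> \<open>reaction_coefficient \<Omega> \<mu>\<^sub>0 \<mu>\<close>
  note V = fe_space_lincomb[OF dom, of _ s k P, folded V_def]
  have V_H1: "v \<in> H1 \<Omega>" if "v \<in> V" for v using that fe_space_H1 by (simp add: V_def)
  have u: "u \<in> H1 \<Omega>" using \<open>u \<in> H10 \<Omega>\<close> by (rule H10_H1)
  have "fe_space s k \<Omega> P \<noteq> {}" using \<open>u\<^sub>h \<in> V\<close> by (auto simp: V_def)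
  then have upos_plus: "upos \<in> Vplus"
    unfolding upos_def Vplus_def
    using \<open>\<aa> > 0\<close> by (intro constrained_part_fe_space_plus dom basis) simp
  have Vplus: "v \<in> V" "x \<in> ?X \<Longrightarrow> 0 \<le> v x \<and> v x \<le> \<aa>" if "v \<in> Vplus" for v x
    using that by (simp_all add: Vplus_def V_def fe_space_plus_def)
  have upos: "upos \<in> V" using upos_plus by (rule Vplus)
  have uneg_eq: "uneg = (\<lambda>x. u\<^sub>h x + (-1) * upos x)"
    by (auto simp: uneg_def upos_def complementary_part_def)
  have uneg: "uneg \<in> V"
    unfolding uneg_eq by (rule V[OF \<open>u\<^sub>h \<in> V\<close> upos])

  have mesh: "\<hh> x \<ge> 0" if "x \<in> ?X" for x
  proof -
    have "x \<in> \<Union>P"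
      using that \<open>conforming_partition s \<Omega> P\<close> closure_subset[of \<Omega>]
      by (auto simp: internal_nodes_def conforming_partition_def)
    then obtain K where "K \<in> P" "x \<in> K" by blast
    then show ?thesis
      by (rule mesh_function_nonneg[OF \<open>conforming_partition s \<Omega> P\<close> \<open>mesh_function s P \<hh>\<close>])
  qed
  have stab_nonneg: "stab v w \<ge> 0" if "\<And>x. x \<in> ?X \<Longrightarrow> v x * w x \<ge> 0" for v w
    unfolding stab_def using \<open>\<alpha> > 0\<close> by (intro s_form_nonneg mesh that) simp_all
  have stab_uneg_nonneg: "stab uneg uneg \<ge> 0"
    by (rule stab_nonneg) simp
  have anorm_nonneg: "anorm v \<ge> 0" if "v \<in> H1 \<Omega>" for v
    unfolding anorm_def by (rule a_norm_nonneg[OF form that])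

  \<comment> \<open>y is left free because u and the finite element solution both reproduce f on V,
    and the bound on \<open>uneg\<close> needs each of them.\<close>
  have error: "(\<lambda>x. y x - upos x) \<in> H1 \<Omega> \<and> a (\<lambda>x. y x - upos x) v = stab uneg v"
    if "y \<in> H1 \<Omega>" "\<forall>v\<in>V. a y v = f v" "v \<in> V" for y v
  proof -
    have "a (\<lambda>x. y x + (-1) * upos x) v = a y v + (-1) * a upos v"
      unfolding a_def by (rule a_form_lincomb[OF form that(1) V_H1[OF upos] V_H1[OF that(3)]])
    moreover have "a upos v + stab uneg v = f v"
      using \<open>\<forall>v\<in>V. a upos v + stab uneg v = f v\<close> that(3) by blast
    ultimately show ?thesis
      using that(2,3) H1_lincomb[OF dom that(1) V_H1[OF upos], of "-1"] by simp
  qed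

  have best: "anorm (\<lambda>x. u x - upos x) \<le> anorm (\<lambda>x. u x - v x)" if v: "v \<in> Vplus" for v
  proof -
    define e where "e = (\<lambda>x. u x - upos x)"
    define w where "w = (\<lambda>x. upos x - v x)"
    have w: "w \<in> V" using V[OF upos Vplus(1)[OF v], of "-1"] by (simp add: w_def)
    \<comment> \<open>V is contained in \<open>H10\<close>, so the equation for u may be tested with
      w.\<close>
    have e: "e \<in> H1 \<Omega>" "a e w = stab uneg w"
      unfolding e_def using error[OF u _ w] \<open>\<forall>v\<in>H10 \<Omega>. a u v = f v\<close>
      by (auto simp: V_def fe_space_def)
    have "uneg x * w x \<ge> 0" if x: "x \<in> ?X" for x
    proof -
      have "upos x = max 0 (min (u\<^sub>h x) \<aa>)"
        unfolding upos_def by (rule constrained_part_node[OF basis x])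
      then show ?thesis
        using clip_sign[of "v x" \<aa> "u\<^sub>h x"] Vplus(2)[OF v x] by (simp add: uneg_eq w_def)
    qed
    then have "a e w \<ge> 0" unfolding e(2) by (rule stab_nonneg)
    moreover have "a w w \<ge> 0"
      unfolding a_def by (rule a_form_pos[OF form V_H1[OF w] V_H1[OF w]])
    \<comment> \<open>The squared distance to v exceeds that to \<open>upos\<close> by 2 a(e, w) +
      a(w, w), and both terms are nonnegative.\<close>
    moreover have "(\<lambda>x. u x - v x) = (\<lambda>x. e x + 1 * w x)"
      by (auto simp: e_def w_def)
    then have "a (\<lambda>x. u x - v x) (\<lambda>x. u x - v x) = a e e + 2 * 1 * a e w + 1\<^sup>2 * a w w"
      unfolding a_def by (simp only: a_form_lincomb_square[OF form e(1) V_H1[OF w]])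
    ultimately have "a e e \<le> a (\<lambda>x. u x - v x) (\<lambda>x. u x - v x)" by simp
    then show ?thesis
      unfolding anorm_def a_norm_def a_def[symmetric] e_def by (rule real_sqrt_le_mono)
  qed

  have stability: "sqrt (stab uneg uneg) \<le> sqrt (C\<^sub>e\<^sub>q\<^sub>u\<^sub>i\<^sub>v / \<alpha>) * anorm (\<lambda>x. y x - upos x)"
    if "y \<in> H1 \<Omega>" "\<forall>v\<in>V. a y v = f v" for y
  proof -
    let ?e = "\<lambda>x. y x - upos x" and ?S = "sqrt (stab uneg uneg)"
    have e: "?e \<in> H1 \<Omega>" "a ?e uneg = stab uneg uneg"
      using error[OF that uneg] by simp_all
    have "(anorm uneg)\<^sup>2 \<le> C\<^sub>e\<^sub>q\<^sub>u\<^sub>i\<^sub>v / \<alpha> * (snorm uneg)\<^sup>2"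
      using \<open>\<forall>v\<in>V. (anorm v)\<^sup>2 \<le> C\<^sub>e\<^sub>q\<^sub>u\<^sub>i\<^sub>v / \<alpha> * (snorm v)\<^sup>2\<close> uneg by blast
    then have "anorm uneg \<le> sqrt (C\<^sub>e\<^sub>q\<^sub>u\<^sub>i\<^sub>v / \<alpha> * (snorm uneg)\<^sup>2)"
      by (rule real_le_rsqrt)
    also have "\<dots> = sqrt (C\<^sub>e\<^sub>q\<^sub>u\<^sub>i\<^sub>v / \<alpha>) * ?S"
    \<comment> \<open>Squaring \<open>snorm\<close> undoes its root only because the stabilisation
      is nonnegative at \<open>uneg\<close>.\<close>
    proof -
      have "(snorm uneg)\<^sup>2 = stab uneg uneg"
        using stab_uneg_nonneg by (simp add: snorm_def s_norm_def stab_def)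
      then show ?thesis by (simp only: real_sqrt_mult)
    qed
    finally have "anorm uneg \<le> sqrt (C\<^sub>e\<^sub>q\<^sub>u\<^sub>i\<^sub>v / \<alpha>) * ?S" .
    then have "anorm ?e * anorm uneg \<le> anorm ?e * (sqrt (C\<^sub>e\<^sub>q\<^sub>u\<^sub>i\<^sub>v / \<alpha>) * ?S)"
      using anorm_nonneg[OF e(1)] by (rule mult_left_mono)
    moreover have "stab uneg uneg \<le> anorm ?e * anorm uneg"
      unfolding e(2)[symmetric] unfolding a_def anorm_def
      by (rule a_form_Cauchy_Schwarz[OF form e(1) V_H1[OF uneg]])
    ultimately have "?S * ?S \<le> sqrt (C\<^sub>e\<^sub>q\<^sub>u\<^sub>i\<^sub>v / \<alpha>) * anorm ?e * ?S"
      using stab_uneg_nonneg by (simp add: mult_ac)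
    moreover have "sqrt (C\<^sub>e\<^sub>q\<^sub>u\<^sub>i\<^sub>v / \<alpha>) * anorm ?e \<ge> 0"
      using anorm_nonneg[OF e(1)] \<open>\<alpha> > 0\<close> \<open>C\<^sub>e\<^sub>q\<^sub>u\<^sub>i\<^sub>v > 0\<close> by simp
    \<comment> \<open>One factor \<open>?S\<close> is cancelled; if it is 0, the claim is the
      nonnegativity of the right side.\<close>
    ultimately show ?thesis
      using real_sqrt_ge_zero[OF stab_uneg_nonneg]
      by (cases "?S = 0") (metis, metis less_eq_real_def mult_right_le_imp_le)
  qed

  have "\<forall>v\<in>V. a u v = f v"
    using \<open>\<forall>v\<in>H10 \<Omega>. a u v = f v\<close> by (simp add: V_def fe_space_def)
  with stability[OF u] stability[OF V_H1] upos_plus best show ?thesis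
    by (auto simp: is_arg_min_def min_def not_less)
qed

end
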